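(* For any extended simple processes $A$ and $B$, we have that $A \sqsubseteq_c B$ if and only if $A \sqsubseteq_c^s B$.
   Context: Setting: terms are built over a signature $\Sigma$ from names $\mathcal{N}$, variables $\mathcal{X}$ and handles $\mathcal{W}$, modulo an equational theory $\mathsf{E}$; a ground term $u$ is valid, $\mathit{valid}(u)$, when every subterm of $u$ is $\mathsf{E}$-equal to a term of a fixed set of ground terms $\mathcal{M}$ (containing a public constant). A basic process on channel $c$ is built from $0$, $\mathtt{if}\ u=v\ \mathtt{then}\ P\ \mathtt{else}\ Q$, $\mathtt{in}(c,x).P$, $\mathtt{out}(c,u).P$; a simple process is a multiset of basic processes on pairwise distinct channels; an extended simple process is a pair $(\mathcal{P};\Phi)$ of a simple process and a frame $\Phi$ (a substitution from handles $w\in\mathcal{W}$ to valid ground terms). In the concrete semantics, an input $\mathtt{in}(c,M)$ uses a recipe $M\in\mathcal{T}(\Sigma,\mathrm{dom}(\Phi))$ with $M\Phi$ valid; an output $\mathtt{out}(c,w)$ of a valid term adds $w\triangleright u$ to the frame; tests are silent ($\tau$) and take the then-branch iff both sides are valid and $\mathsf{E}$-equal. Two frames are statically equivalent, $\Phi\sim\Phi'$, if they have the same domain, the same recipes yield valid terms, and the same pairs of valid recipes yield $\mathsf{E}$-equal terms. The compressed semantics $\xrightarrow{\mathsf{tr}}_c$ executes actions in maximal blocks: a proper block is a non-empty sequence of inputs on one channel $c$ followed by a maximal sequence of outputs on $c$ (with $\tau$ actions performed implicitly), after which the basic process must be null, waiting for an input, or blocked on an output of an invalid term; an improper block (a sequence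 of inputs on one channel after which the basic process terminates or is blocked on an output, discarding the whole process) may only occur at the end of a trace. $A \sqsubseteq_c B$ means: for every $\mathsf{tr}$ with $A \xrightarrow{\mathsf{tr}}_c (\mathcal{P}';\Phi')$, there is $(\mathcal{Q}';\Psi')$ with $B \xrightarrow{\mathsf{tr}}_c (\mathcal{Q}';\Psi')$ and $\Phi'\sim\Psi'$. Symbolic side: a constraint system $(\Phi;\mathcal{S})$ contains deduction constraints $D \vdash^? X : x$ (second-order variable $X$ to be instantiated by a recipe over handles $D$ yielding $x$), and equations/disequations $u=^?v$, $u\neq^?v$; a solution $\theta$ maps second-order variables to recipes over the allowed handles such that, with its (unique modulo $\mathsf{E}$) associated first-order substitution $\lambda_\theta$, all deductions hold with valid terms, equations hold between valid terms, disequations hold (or a side is invalid), and $\Phi\lambda_\theta$ is valid; $\mathsf{Sol}$ denotes the set of solutions. The compressed symbolic semantics $\xrightarrow{\mathsf{tr}}_{cs}$ on symbolic processes $(\mathcal{P};\Phi;\mathcal{S})$ mirrors the compressed semantics, with inputs $\mathtt{in}(c,X)$ adding $\mathrm{dom}(\Phi)\vdash^? X:x$, tests adding $u=^?v$ or $u\neq^?v$, and blocked outputs of $u$ adding $u\neq^?u$. $(\mathcal{P};\Phi)\sqsubseteq_c^s(\mathcal{Q};\Psi)$ means: for every $\mathsf{tr}$ with $(\mathcal{P};\Phi;\varnothing)\xrightarrow{\mathsf{tr}}_{cs}(\mathcal{P}';\Phi';\mathcal{S}_A)$ and every $\theta\in\mathsf{Sol}(\Phi';\mathcal{S}_A)$,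 there is $(\mathcal{Q};\Psi;\varnothing)\xrightarrow{\mathsf{tr}}_{cs}(\mathcal{Q}';\Psi';\mathcal{S}_B)$ with $\theta\in\mathsf{Sol}(\Psi';\mathcal{S}_B)$ and $\Phi'\lambda^A_\theta\sim\Psi'\lambda^B_\theta$, where $\lambda^A_\theta,\lambda^B_\theta$ are the first-order substitutions associated to $\theta$ in the respective constraint systems. *)

theory Defs
  imports "HOL-Library.Multiset" "HOL-Library.Infinite_Typeclass"
begin

section \<open>Terms\<close>

text \<open>
  Terms over function symbols \<open>'f\<close> and atoms \<open>'a\<close>. Messages have names and first-order variables
  as atoms, recipes have handles as atoms. Since names are not available in recipes, the attacker
  does not know them a priori; every function symbol is public.
\<close>

datatype ('f, atoms: 'a) trm = Atom 'a | App 'f "('f, 'a) trm list"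

datatype ('n, 'x) atom = Nam 'n | Vrb 'x

type_synonym ('f, 'n, 'x) msg = "('f, ('n, 'x) atom) trm"
type_synonym ('f, 'w) recipe = "('f, 'w) trm"

text \<open>\<open>terms_over ar A\<close> is the set of terms respecting the arities \<open>ar\<close>, with atoms in \<open>A\<close>.\<close>

inductive_set terms_over :: "('f \<Rightarrow> nat) \<Rightarrow> 'a set \<Rightarrow> ('f, 'a) trm set"
  for ar :: "'f \<Rightarrow> nat" and A :: "'a set" where
  "a \<in> A \<Longrightarrow> Atom a \<in> terms_over ar A"
| "length ts = ar f \<Longrightarrow> (\<And>t. t \<in> set ts \<Longrightarrow> t \<in> terms_over ar A) \<Longrightarrow> App f ts \<in> terms_over ar A"

primrec subterms :: "('f, 'a) trm \<Rightarrow> ('f, 'a) trm set" where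
  "subterms (Atom a) = {Atom a}"
| "subterms (App f ts) = insert (App f ts) (\<Union> (set (map subterms ts)))"

primrec tbind :: "('a \<Rightarrow> ('f, 'b) trm) \<Rightarrow> ('f, 'a) trm \<Rightarrow> ('f, 'b) trm" where
  "tbind s (Atom a) = s a"
| "tbind s (App f ts) = App f (map (tbind s) ts)"

definition tvars :: "('f, 'n, 'x) msg \<Rightarrow> 'x set" where
  "tvars t = {x. Vrb x \<in> atoms t}"

fun atom_subst :: "('x \<rightharpoonup> ('f, 'n, 'x) msg) \<Rightarrow> ('n, 'x) atom \<Rightarrow> ('f, 'n, 'x) msg" where
  "atom_subst s (Nam n) = Atom (Nam n)"
| "atom_subst s (Vrb x) = (case s x of None \<Rightarrow> Atom (Vrb x) | Some t \<Rightarrow> t)"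

definition msubst :: "('x \<rightharpoonup> ('f, 'n, 'x) msg) \<Rightarrow> ('f, 'n, 'x) msg \<Rightarrow> ('f, 'n, 'x) msg" where
  "msubst s = tbind (atom_subst s)"

section \<open>Frames and processes\<close>

type_synonym ('f, 'n, 'x, 'w) frame = "'w \<rightharpoonup> ('f, 'n, 'x) msg"

text \<open>The message computed by a recipe; only meaningful for recipes over the domain of the frame.\<close>

definition rapply :: "('f, 'n, 'x, 'w) frame \<Rightarrow> ('f, 'w) recipe \<Rightarrow> ('f, 'n, 'x) msg" where
  "rapply \<Phi> = tbind (\<lambda>w. the (\<Phi> w))"

definition frame_subst ::
  "('x \<rightharpoonup> ('f, 'n, 'x) msg) \<Rightarrow> ('f, 'n, 'x, 'w) frame \<Rightarrow> ('f, 'n, 'x, 'w) frame" where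
  "frame_subst s \<Phi> = map_option (msubst s) \<circ> \<Phi>"

definition frame_vars :: "('f, 'n, 'x, 'w) frame \<Rightarrow> 'x set" where
  "frame_vars \<Phi> = (\<Union>t\<in>ran \<Phi>. tvars t)"

datatype ('f, 'n, 'x, 'c) proc =
    PNull
  | PIf "('f, 'n, 'x) msg" "('f, 'n, 'x) msg" "('f, 'n, 'x, 'c) proc" "('f, 'n, 'x, 'c) proc"
  | PIn 'c 'x "('f, 'n, 'x, 'c) proc"
  | POut 'c "('f, 'n, 'x) msg" "('f, 'n, 'x, 'c) proc"

primrec pfree :: "('f, 'n, 'x, 'c) proc \<Rightarrow> 'x set" where
  "pfree PNull = {}"
| "pfree (PIf u v P Q) = tvars u \<union> tvars v \<union> pfree P \<union> pfree Q"
| "pfree (PIn c x P) = pfree P - {x}"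
| "pfree (POut c u P) = tvars u \<union> pfree P"

text \<open>All variables, bound ones included.\<close>

primrec pvars :: "('f, 'n, 'x, 'c) proc \<Rightarrow> 'x set" where
  "pvars PNull = {}"
| "pvars (PIf u v P Q) = tvars u \<union> tvars v \<union> pvars P \<union> pvars Q"
| "pvars (PIn c x P) = insert x (pvars P)"
| "pvars (POut c u P) = tvars u \<union> pvars P"

text \<open>
  Replacement of free occurrences. It does not rename binders; below it is only used with ground
  terms and with variables not occurring in the process at all, so that no capture can happen.
\<close>

primrec psubst ::
  "('x \<rightharpoonup> ('f, 'n, 'x) msg) \<Rightarrow> ('f, 'n, 'x, 'c) proc \<Rightarrow> ('f, 'n, 'x, 'c) proc" where
  "psubst s PNull = PNull"
| "psubst s (PIf u v P Q) = PIf (msubst s u) (msubst s v) (psubst s P) (psubst s Q)"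
| "psubst s (PIn c x P) = PIn c x (psubst (s(x := None)) P)"
| "psubst s (POut c u P) = POut c (msubst s u) (psubst s P)"

type_synonym ('f, 'n, 'x, 'c, 'w) eproc =
  "('f, 'n, 'x, 'c) proc multiset \<times> ('f, 'n, 'x, 'w) frame"

section \<open>Constraints and actions\<close>

text \<open>A countably infinite supply of second-order variables.\<close>

datatype sovar = SOVar nat

text \<open>\<open>Ded D X x\<close> is the deduction constraint: \<open>X\<close> is a recipe over the handles \<open>D\<close> yielding \<open>x\<close>.\<close>

datatype ('f, 'n, 'x, 'w) constr =
    Ded "'w set" sovar 'x
  | Equ "('f, 'n, 'x) msg" "('f, 'n, 'x) msg"
  | Neq "('f, 'n, 'x) msg" "('f, 'n, 'x) msg"

fun constr_vars :: "('f, 'n, 'x, 'w) constr \<Rightarrow> 'x set" where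
  "constr_vars (Ded D X x) = {x}"
| "constr_vars (Equ u v) = tvars u \<union> tvars v"
| "constr_vars (Neq u v) = tvars u \<union> tvars v"

type_synonym ('f, 'n, 'x, 'w) csys =
  "('f, 'n, 'x, 'w) frame \<times> ('f, 'n, 'x, 'w) constr set"

fun csys_vars :: "('f, 'n, 'x, 'w) csys \<Rightarrow> 'x set" where
  "csys_vars (\<Phi>, S) = frame_vars \<Phi> \<union> (\<Union>k\<in>S. constr_vars k)"

definition so_vars :: "('f, 'n, 'x, 'w) constr set \<Rightarrow> sovar set" where
  "so_vars S = {X. \<exists>D x. Ded D X x \<in> S}"

type_synonym ('f, 'n, 'x, 'c, 'w) sproc =
  "('f, 'n, 'x, 'c) proc multiset \<times> ('f, 'n, 'x, 'w) frame \<times> ('f, 'n, 'x, 'w) constr set"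

text \<open>Inputs carry a recipe (concrete semantics) or a second-order variable (symbolic semantics).\<close>

datatype ('c, 'i, 'w) action = In_act 'c 'i | Out_act 'c 'w | Tau

text \<open>
  Modes of the focused execution of one basic process inside a block: \<open>In_Plus\<close> if at least one input
  is still required, \<open>In_Star\<close> if further inputs or a first output are possible, \<open>Out_Star\<close> if only
  further outputs are possible.
\<close>

datatype mode = In_Plus | In_Star | Out_Star

section \<open>Compressed symbolic semantics\<close>

text \<open>
  The first-order variable introduced by an input must not occur in the executed basic process
  (not even bound), the frame or the constraints. The free variables of the other basic processes
  occur in the constraints, as executions start from closed processes.
\<close>

inductive sym_step :: "('f, 'n, 'x, 'c) proc \<Rightarrow> ('f, 'n, 'x, 'w) frame \<Rightarrow>
    ('f, 'n, 'x, 'w) constr set \<Rightarrow> ('c, sovar, 'w) action \<Rightarrow>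
    ('f, 'n, 'x, 'c) proc \<Rightarrow> ('f, 'n, 'x, 'w) frame \<Rightarrow> ('f, 'n, 'x, 'w) constr set \<Rightarrow> bool" where
  sym_in: "X \<notin> so_vars S \<Longrightarrow> x \<notin> csys_vars (\<Phi>, S) \<union> pvars (PIn c y P) \<Longrightarrow>
    sym_step (PIn c y P) \<Phi> S (In_act c X)
      (psubst [y \<mapsto> Atom (Vrb x)] P) \<Phi> (insert (Ded (dom \<Phi>) X x) S)"
| sym_out: "w \<notin> dom \<Phi> \<Longrightarrow> sym_step (POut c u P) \<Phi> S (Out_act c w) P (\<Phi>(w \<mapsto> u)) S"
| sym_then: "sym_step (PIf u v P Q) \<Phi> S Tau P \<Phi> (insert (Equ u v) S)"
| sym_else: "sym_step (PIf u v P Q) \<Phi> S Tau Q \<Phi> (insert (Neq u v) S)"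

inductive sym_focus :: "mode \<Rightarrow> ('f, 'n, 'x, 'c) proc \<Rightarrow> ('f, 'n, 'x, 'w) frame \<Rightarrow>
    ('f, 'n, 'x, 'w) constr set \<Rightarrow> ('c, sovar, 'w) action list \<Rightarrow>
    ('f, 'n, 'x, 'c) proc option \<Rightarrow> ('f, 'n, 'x, 'w) frame \<Rightarrow>
    ('f, 'n, 'x, 'w) constr set \<Rightarrow> bool" where
  sym_focus_in: "m \<in> {In_Plus, In_Star} \<Longrightarrow> sym_step P \<Phi> S (In_act c X) P' \<Phi>' S' \<Longrightarrow>
    sym_focus In_Star P' \<Phi>' S' tr r \<Phi>'' S'' \<Longrightarrow> sym_focus m P \<Phi> S (In_act c X # tr) r \<Phi>'' S''"
| sym_focus_out: "m \<in> {In_Star, Out_Star} \<Longrightarrow> sym_step P \<Phi> S (Out_act c w) P' \<Phi>' S' \<Longrightarrow>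
    sym_focus Out_Star P' \<Phi>' S' tr r \<Phi>'' S'' \<Longrightarrow> sym_focus m P \<Phi> S (Out_act c w # tr) r \<Phi>'' S''"
| sym_focus_tau: "sym_step P \<Phi> S Tau P' \<Phi>' S' \<Longrightarrow>
    sym_focus m P' \<Phi>' S' tr r \<Phi>'' S'' \<Longrightarrow> sym_focus m P \<Phi> S tr r \<Phi>'' S''"
| sym_proper_null: "sym_focus Out_Star PNull \<Phi> S [] (Some PNull) \<Phi> S"
| sym_proper_in: "sym_focus Out_Star (PIn c x P) \<Phi> S [] (Some (PIn c x P)) \<Phi> S"
| sym_proper_blocked:
    "sym_focus Out_Star (POut c u P) \<Phi> S [] (Some (POut c u P)) \<Phi> (insert (Neq u u) S)"
| sym_improper_null: "sym_focus In_Star PNull \<Phi> S [] None \<Phi> S"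
| sym_improper_blocked: "sym_focus In_Star (POut c u P) \<Phi> S [] None \<Phi> (insert (Neq u u) S)"

inductive sym_compressed :: "('f, 'n, 'x, 'c, 'w) sproc \<Rightarrow>
    ('c, sovar, 'w) action list \<Rightarrow> ('f, 'n, 'x, 'c, 'w) sproc \<Rightarrow> bool" where
  sym_comp_nil: "sym_compressed A [] A"
| sym_comp_block: "sym_focus In_Plus P \<Phi> S tr (Some P') \<Phi>' S' \<Longrightarrow>
    sym_compressed (add_mset P' \<P>, \<Phi>', S') tr' A' \<Longrightarrow>
    sym_compressed (add_mset P \<P>, \<Phi>, S) (tr @ tr') A'"
| sym_comp_failure: "sym_focus In_Plus P \<Phi> S tr None \<Phi>' S' \<Longrightarrow>
    sym_compressed ({#}, \<Phi>', S') tr' A' \<Longrightarrow>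
    sym_compressed (add_mset P \<P>, \<Phi>, S) (tr @ tr') A'"

section \<open>The term model\<close>

text \<open>
  Every element of the type \<open>'f\<close> is a symbol of the signature, with arity given by \<open>ar\<close>. The relation
  \<open>E\<close> is an equational theory: a congruence on terms closed under substitution.
\<close>

locale term_model =
  fixes ar :: "'f \<Rightarrow> nat"
    and E :: "('f, 'n, 'x) msg rel"
    and M :: "('f, 'n, 'x) msg set"
  assumes E_equiv: "equiv (terms_over ar UNIV) E"
    and E_cong: "\<And>f ts us. length ts = ar f \<Longrightarrow> list_all2 (\<lambda>t u. (t, u) \<in> E) ts us \<Longrightarrow>
          (App f ts, App f us) \<in> E"
    and E_subst: "\<And>s t u. ran s \<subseteq> terms_over ar UNIV \<Longrightarrow> (t, u) \<in> E \<Longrightarrow>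
          (msubst s t, msubst s u) \<in> E"
    and M_ground: "M \<subseteq> terms_over ar (range Nam)"
    and M_const: "\<exists>f. ar f = 0 \<and> App f [] \<in> M"
begin

definition valid :: "('f, 'n, 'x) msg \<Rightarrow> bool" where
  "valid u \<longleftrightarrow> u \<in> terms_over ar (range Nam) \<and> (\<forall>v\<in>subterms u. \<exists>m\<in>M. (v, m) \<in> E)"

primrec basic_process :: "'c \<Rightarrow> ('f, 'n, 'x, 'c) proc \<Rightarrow> bool" where
  "basic_process c PNull \<longleftrightarrow> True"
| "basic_process c (PIf u v P Q) \<longleftrightarrow>
     u \<in> terms_over ar UNIV \<and> v \<in> terms_over ar UNIV \<and> basic_process c P \<and> basic_process c Q"
| "basic_process c (PIn d x P) \<longleftrightarrow> d = c \<and> basic_process c P"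
| "basic_process c (POut d u P) \<longleftrightarrow> d = c \<and> u \<in> terms_over ar UNIV \<and> basic_process c P"

definition simple_process :: "('f, 'n, 'x, 'c) proc multiset \<Rightarrow> bool" where
  "simple_process \<P> \<longleftrightarrow>
     (\<exists>ps. \<P> = mset (map snd ps) \<and> distinct (map fst ps) \<and>
           (\<forall>(c, P)\<in>set ps. basic_process c P))"

fun extended_simple_process :: "('f, 'n, 'x, 'c, 'w) eproc \<Rightarrow> bool" where
  "extended_simple_process (\<P>, \<Phi>) \<longleftrightarrow>
     simple_process \<P> \<and> (\<forall>P\<in>#\<P>. pfree P = {}) \<and>
     finite (dom \<Phi>) \<and> (\<forall>u\<in>ran \<Phi>. valid u)"

definition static_equiv :: "('f, 'n, 'x, 'w) frame \<Rightarrow> ('f, 'n, 'x, 'w) frame \<Rightarrow> bool" where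
  "static_equiv \<Phi> \<Psi> \<longleftrightarrow>
     dom \<Phi> = dom \<Psi> \<and>
     (\<forall>R\<in>terms_over ar (dom \<Phi>). valid (rapply \<Phi> R) \<longleftrightarrow> valid (rapply \<Psi> R)) \<and>
     (\<forall>R\<in>terms_over ar (dom \<Phi>). \<forall>R'\<in>terms_over ar (dom \<Phi>).
        valid (rapply \<Phi> R) \<longrightarrow> valid (rapply \<Phi> R') \<longrightarrow>
        ((rapply \<Phi> R, rapply \<Phi> R') \<in> E \<longleftrightarrow> (rapply \<Psi> R, rapply \<Psi> R') \<in> E))"

section \<open>Concrete and compressed semantics\<close>

text \<open>
  The transitions of one basic process in a frame. The other basic processes of a simple process
  are left untouched by a transition, and contain no handles, hence are irrelevant for freshness.
\<close>

inductive step :: "('f, 'n, 'x, 'c) proc \<Rightarrow> ('f, 'n, 'x, 'w) frame \<Rightarrow>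
    ('c, ('f, 'w) recipe, 'w) action \<Rightarrow>
    ('f, 'n, 'x, 'c) proc \<Rightarrow> ('f, 'n, 'x, 'w) frame \<Rightarrow> bool" where
  step_in: "R \<in> terms_over ar (dom \<Phi>) \<Longrightarrow> valid (rapply \<Phi> R) \<Longrightarrow>
    step (PIn c x P) \<Phi> (In_act c R) (psubst [x \<mapsto> rapply \<Phi> R] P) \<Phi>"
| step_out: "w \<notin> dom \<Phi> \<Longrightarrow> valid u \<Longrightarrow> step (POut c u P) \<Phi> (Out_act c w) P (\<Phi>(w \<mapsto> u))"
| step_then: "valid u \<Longrightarrow> valid v \<Longrightarrow> (u, v) \<in> E \<Longrightarrow> step (PIf u v P Q) \<Phi> Tau P \<Phi>"
| step_else: "\<not> (valid u \<and> valid v \<and> (u, v) \<in> E) \<Longrightarrow> step (PIf u v P Q) \<Phi> Tau Q \<Phi>"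

text \<open>
  Execution of one block by one basic process. The result \<open>None\<close> marks an improper block. In a
  proper block, at least one output is performed.
\<close>

inductive focus :: "mode \<Rightarrow> ('f, 'n, 'x, 'c) proc \<Rightarrow> ('f, 'n, 'x, 'w) frame \<Rightarrow>
    ('c, ('f, 'w) recipe, 'w) action list \<Rightarrow>
    ('f, 'n, 'x, 'c) proc option \<Rightarrow> ('f, 'n, 'x, 'w) frame \<Rightarrow> bool" where
  focus_in: "m \<in> {In_Plus, In_Star} \<Longrightarrow> step P \<Phi> (In_act c R) P' \<Phi>' \<Longrightarrow>
    focus In_Star P' \<Phi>' tr r \<Phi>'' \<Longrightarrow> focus m P \<Phi> (In_act c R # tr) r \<Phi>''"
| focus_out: "m \<in> {In_Star, Out_Star} \<Longrightarrow> step P \<Phi> (Out_act c w) P' \<Phi>' \<Longrightarrow>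
    focus Out_Star P' \<Phi>' tr r \<Phi>'' \<Longrightarrow> focus m P \<Phi> (Out_act c w # tr) r \<Phi>''"
| focus_tau: "step P \<Phi> Tau P' \<Phi>' \<Longrightarrow> focus m P' \<Phi>' tr r \<Phi>'' \<Longrightarrow> focus m P \<Phi> tr r \<Phi>''"
| proper_null: "focus Out_Star PNull \<Phi> [] (Some PNull) \<Phi>"
| proper_in: "focus Out_Star (PIn c x P) \<Phi> [] (Some (PIn c x P)) \<Phi>"
| proper_blocked: "\<not> valid u \<Longrightarrow> focus Out_Star (POut c u P) \<Phi> [] (Some (POut c u P)) \<Phi>"
| improper_null: "focus In_Star PNull \<Phi> [] None \<Phi>"
| improper_blocked: "\<not> valid u \<Longrightarrow> focus In_Star (POut c u P) \<Phi> [] None \<Phi>"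

text \<open>An improper block discards the whole process, so that no block can follow it.\<close>

inductive compressed :: "('f, 'n, 'x, 'c, 'w) eproc \<Rightarrow>
    ('c, ('f, 'w) recipe, 'w) action list \<Rightarrow> ('f, 'n, 'x, 'c, 'w) eproc \<Rightarrow> bool" where
  comp_nil: "compressed A [] A"
| comp_block: "focus In_Plus P \<Phi> tr (Some P') \<Phi>' \<Longrightarrow>
    compressed (add_mset P' \<P>, \<Phi>') tr' A' \<Longrightarrow> compressed (add_mset P \<P>, \<Phi>) (tr @ tr') A'"
| comp_failure: "focus In_Plus P \<Phi> tr None \<Phi>' \<Longrightarrow>
    compressed ({#}, \<Phi>') tr' A' \<Longrightarrow> compressed (add_mset P \<P>, \<Phi>) (tr @ tr') A'"

definition comp_incl ::
  "('f, 'n, 'x, 'c, 'w) eproc \<Rightarrow> ('f, 'n, 'x, 'c, 'w) eproc \<Rightarrow> bool" where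
  "comp_incl A B \<longleftrightarrow>
     (\<forall>tr \<P>' \<Phi>'. compressed A tr (\<P>', \<Phi>') \<longrightarrow>
        (\<exists>\<Q>' \<Psi>'. compressed B tr (\<Q>', \<Psi>') \<and> static_equiv \<Phi>' \<Psi>'))"

section \<open>Solutions of constraint systems\<close>

definition assoc_subst :: "('f, 'n, 'x, 'w) csys \<Rightarrow> (sovar \<rightharpoonup> ('f, 'w) recipe) \<Rightarrow>
    ('x \<rightharpoonup> ('f, 'n, 'x) msg) \<Rightarrow> bool" where
  "assoc_subst C \<theta> l \<longleftrightarrow> (case C of (\<Phi>, S) \<Rightarrow>
     dom l = csys_vars (\<Phi>, S) \<and> ran l \<subseteq> terms_over ar (range Nam) \<and>
     (\<forall>D X x. Ded D X x \<in> S \<longrightarrow>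
        (let u = rapply (frame_subst l \<Phi>) (the (\<theta> X)); v = msubst l (Atom (Vrb x))
         in (u, v) \<in> E \<and> valid u \<and> valid v)) \<and>
     (\<forall>u v. Equ u v \<in> S \<longrightarrow>
        (msubst l u, msubst l v) \<in> E \<and> valid (msubst l u) \<and> valid (msubst l v)) \<and>
     (\<forall>u v. Neq u v \<in> S \<longrightarrow>
        (msubst l u, msubst l v) \<notin> E \<or> \<not> valid (msubst l u) \<or> \<not> valid (msubst l v)) \<and>
     (\<forall>u\<in>ran (frame_subst l \<Phi>). valid u))"

definition Sol :: "('f, 'n, 'x, 'w) csys \<Rightarrow> (sovar \<rightharpoonup> ('f, 'w) recipe) set" where
  "Sol C = (case C of (\<Phi>, S) \<Rightarrow>
     {\<theta>. dom \<theta> = so_vars S \<and>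
         (\<forall>D X x. Ded D X x \<in> S \<longrightarrow> the (\<theta> X) \<in> terms_over ar D) \<and>
         (\<exists>l. assoc_subst (\<Phi>, S) \<theta> l)})"

text \<open>
  For the constraint systems arising from the symbolic semantics the associated substitution is
  unique only modulo \<open>E\<close>; one representative is picked.
\<close>

definition fo_subst :: "('f, 'n, 'x, 'w) csys \<Rightarrow> (sovar \<rightharpoonup> ('f, 'w) recipe) \<Rightarrow>
    ('x \<rightharpoonup> ('f, 'n, 'x) msg)" where
  "fo_subst C \<theta> = (SOME l. assoc_subst C \<theta> l)"

section \<open>Symbolic inclusion\<close>

fun sym_comp_incl ::
  "('f, 'n, 'x, 'c, 'w) eproc \<Rightarrow> ('f, 'n, 'x, 'c, 'w) eproc \<Rightarrow> bool" where
  "sym_comp_incl (\<P>, \<Phi>) (\<Q>, \<Psi>) \<longleftrightarrow>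
     (\<forall>tr \<P>' \<Phi>' S\<^sub>A \<theta>.
        sym_compressed (\<P>, \<Phi>, {}) tr (\<P>', \<Phi>', S\<^sub>A) \<and> \<theta> \<in> Sol (\<Phi>', S\<^sub>A) \<longrightarrow>
        (\<exists>\<Q>' \<Psi>' S\<^sub>B.
           sym_compressed (\<Q>, \<Psi>, {}) tr (\<Q>', \<Psi>', S\<^sub>B) \<and> \<theta> \<in> Sol (\<Psi>', S\<^sub>B) \<and>
           static_equiv (frame_subst (fo_subst (\<Phi>', S\<^sub>A) \<theta>) \<Phi>')
                        (frame_subst (fo_subst (\<Psi>', S\<^sub>B) \<theta>) \<Psi>')))"

end

end

theory Submission
  imports Defs
begin

text \<open>
  A symbolic execution together with a solution \<open>\<theta>\<close> determines a concrete execution, once each input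
  variable is replaced by exactly the message computed by its recipe. Such a canonical substitution
  exists for every constraint system generated by the symbolic semantics, because the constraint of a
  variable only involves handles whose messages contain earlier variables. By induction along the
  same order, every first-order substitution associated to \<open>\<theta>\<close> is \<open>E\<close>-equal to it, and as validity is
  preserved by replacing subterms by \<open>E\<close>-equal ones of the same validity, it yields statically
  equivalent frames. Conversely, a concrete execution is lifted step by step, recording the tests as
  constraints and naming its recipes by distinct second-order variables.
\<close>

section \<open>Terms and substitutions\<close>

text \<open>Both sides of the inclusion must be solved by one and the same \<theta>, although they
  generate different constraint systems. This is possible because the second-order variables of a
  generated system are exactly the inputs of its trace, so the domain required by \<open>Sol\<close>
  depends on the trace alone. Completeness is therefore stated for a prescribed trace and a
  prescribed \<theta>.

  The obstacle is validity. It inspects all subterms, so a message that is \<open>E\<close>-equal to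
  a valid one may itself be invalid. Yet tests, blocked outputs and static equivalence all depend on
  validity, so that agreement modulo \<open>E\<close> alone would not allow one associated
  substitution to replace another. Hence the relation \<open>veq\<close>, which also demands equal
  validity. Solutions provide it at the variables: a deduction constraint makes both the result of
  the recipe and the value of the variable valid.\<close>

lemma tbind_cong: "(\<And>a. a \<in> atoms t \<Longrightarrow> s a = s' a) \<Longrightarrow> tbind s t = tbind s' t"
  by (induction t) auto

lemma tbind_tbind: "tbind s (tbind s' t) = tbind (\<lambda>a. tbind s (s' a)) t"
  by (induction t) auto

lemma tbind_Atom: "tbind Atom t = t"
  by (induction t) (auto intro: map_idI)

lemma atoms_tbind: "atoms (tbind s t) = (\<Union>a\<in>atoms t. atoms (s a))"
  by (induction t) auto

lemma terms_over_atoms: "t \<in> terms_over ar A \<Longrightarrow> atoms t \<subseteq> A"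
  by (induction rule: terms_over.induct) auto

lemma terms_over_UNIV: "t \<in> terms_over ar A \<Longrightarrow> t \<in> terms_over ar UNIV"
  by (induction rule: terms_over.induct) (auto intro: terms_over.intros)

lemma tbind_terms_over:
  "t \<in> terms_over ar A \<Longrightarrow> (\<And>a. a \<in> atoms t \<Longrightarrow> s a \<in> terms_over ar B) \<Longrightarrow>
    tbind s t \<in> terms_over ar B"
proof (induction rule: terms_over.induct)
  case (2 ts f)
  then have "tbind s t \<in> terms_over ar B" if "t \<in> set ts" for t
    using that by auto
  with 2(1) show ?case by (auto intro!: terms_over.intros)
qed auto

lemma tvars_ground: "t \<in> terms_over ar (range Nam) \<Longrightarrow> tvars t = {}"
  using terms_over_atoms by (fastforce simp: tvars_def)

lemma finite_tvars: "finite (tvars t)"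
proof -
  have "Vrb ` tvars t \<subseteq> atoms t" by (auto simp: tvars_def)
  moreover have "finite (atoms t)" by (induction t) auto
  ultimately show ?thesis
    by (meson atom.inject(2) finite_imageD finite_subset inj_onI)
qed

lemma tvars_Vrb [simp]: "tvars (Atom (Vrb x)) = {x}"
  by (auto simp: tvars_def)

lemma tvars_atom: "Vrb x \<in> atoms t \<Longrightarrow> x \<in> tvars t"
  by (simp add: tvars_def)

lemma msubst_cong: "(\<And>x. x \<in> tvars t \<Longrightarrow> l x = l' x) \<Longrightarrow> msubst l t = msubst l' t"
  unfolding msubst_def
proof (rule tbind_cong)
  fix a assume "\<And>x. x \<in> tvars t \<Longrightarrow> l x = l' x" "a \<in> atoms t"
  then show "atom_subst l a = atom_subst l' a" by (cases a) (auto dest: tvars_atom)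
qed

lemma atom_subst_empty: "atom_subst Map.empty = Atom"
proof
  fix a show "atom_subst Map.empty a = Atom a" by (cases a) auto
qed

lemma msubst_empty [simp]: "msubst Map.empty t = t"
  by (simp add: msubst_def atom_subst_empty tbind_Atom)

lemma msubst_fresh: "tvars t \<inter> dom l = {} \<Longrightarrow> msubst l t = t"
  using msubst_cong[of t l Map.empty] by fastforce

lemma msubst_Vrb [simp]: "msubst l (Atom (Vrb x)) = (case l x of None \<Rightarrow> Atom (Vrb x) | Some t \<Rightarrow> t)"
  by (simp add: msubst_def)

text \<open>Composed substitutions are compared variable by variable, which avoids introducing a
  composition operator on partial maps.\<close>

lemma msubst_msubst_cong:
  assumes "\<And>v. v \<in> tvars t \<Longrightarrow> msubst l (msubst s (Atom (Vrb v))) = msubst l' (msubst s' (Atom (Vrb v)))"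
  shows "msubst l (msubst s t) = msubst l' (msubst s' t)"
  unfolding msubst_def tbind_tbind
proof (rule tbind_cong)
  fix a assume "a \<in> atoms t"
  with assms show "tbind (atom_subst l) (atom_subst s a) = tbind (atom_subst l') (atom_subst s' a)"
    by (cases a) (auto simp: msubst_def dest: tvars_atom)
qed

lemma tvars_msubst: "tvars (msubst l t) \<subseteq> (tvars t - dom l) \<union> \<Union> (tvars ` ran l)"
proof
  fix x assume "x \<in> tvars (msubst l t)"
  then obtain a where a: "a \<in> atoms t" "Vrb x \<in> atoms (atom_subst l a)"
    by (auto simp: tvars_def msubst_def atoms_tbind)
  then show "x \<in> (tvars t - dom l) \<union> \<Union> (tvars ` ran l)"
    by (cases a rule: atom.exhaust) (auto simp: tvars_def ran_def split: option.splits)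
qed

lemma msubst_terms_over:
  assumes "t \<in> terms_over ar UNIV" "ran l \<subseteq> terms_over ar UNIV"
  shows "msubst l t \<in> terms_over ar UNIV"
  unfolding msubst_def
proof (rule tbind_terms_over[OF assms(1)])
  fix a show "atom_subst l a \<in> terms_over ar UNIV"
    using assms(2) by (cases a) (auto simp: ran_def intro: terms_over.intros split: option.splits)
qed

lemma msubst_ground:
  assumes "t \<in> terms_over ar UNIV" "ran l \<subseteq> terms_over ar (range Nam)" "tvars t \<subseteq> dom l"
  shows "msubst l t \<in> terms_over ar (range Nam)"
  unfolding msubst_def
proof (rule tbind_terms_over[OF assms(1)])
  fix a assume "a \<in> atoms t"
  with assms(2,3) show "atom_subst l a \<in> terms_over ar (range Nam)"
    by (cases a) (auto 0 4 simp: ran_def intro: terms_over.intros dest: tvars_atom split: option.splits)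
qed

section \<open>Processes and frames under substitution\<close>

lemma psubst_cong: "(\<And>x. x \<in> pfree P \<Longrightarrow> l x = l' x) \<Longrightarrow> psubst l P = psubst l' P"
proof (induction P arbitrary: l l')
  case (PIf u v P Q)
  have "psubst l P = psubst l' P" "psubst l Q = psubst l' Q"
    by (rule PIf.IH, rule PIf.prems, simp)+
  moreover have "msubst l u = msubst l' u" "msubst l v = msubst l' v"
    by (rule msubst_cong, rule PIf.prems, simp)+
  ultimately show ?case by simp
next
  case (PIn c z P)
  have "psubst (l(z := None)) P = psubst (l'(z := None)) P"
  proof (rule PIn.IH)
    fix x assume "x \<in> pfree P"
    then show "(l(z := None)) x = (l'(z := None)) x" using PIn.prems[of x] by (cases "x = z") auto
  qed
  then show ?case by simp
next
  case (POut c u P)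
  have "psubst l P = psubst l' P"
    by (rule POut.IH, rule POut.prems, simp)
  moreover have "msubst l u = msubst l' u"
    by (rule msubst_cong, rule POut.prems, simp)
  ultimately show ?case by simp
qed simp

lemma psubst_empty [simp]: "psubst Map.empty P = P"
  by (induction P) auto

lemma psubst_closed: "pfree P = {} \<Longrightarrow> psubst l P = P"
  using psubst_cong[of P l Map.empty] by simp

text \<open>\<open>psubst\<close> does not rename binders, so the second hypothesis rules out
  capture: terms inserted by the inner substitutions avoid all variables of \<open>P\<close>,
  including bound ones. It is \<open>pvars\<close> rather than \<open>pfree\<close> that makes the
  induction go through below an input.\<close>

lemma psubst_psubst_cong:
  assumes "\<And>v. v \<in> pfree P \<Longrightarrow> msubst l (msubst s (Atom (Vrb v))) = msubst l' (msubst s' (Atom (Vrb v)))"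
    and "\<And>t. t \<in> ran s \<union> ran s' \<Longrightarrow> tvars t \<inter> pvars P = {}"
  shows "psubst l (psubst s P) = psubst l' (psubst s' P)"
  using assms
proof (induction P arbitrary: l s l' s')
  case (PIf u v P Q)
  have "psubst l (psubst s P) = psubst l' (psubst s' P)"
    by (rule PIf.IH) (use PIf.prems in fastforce)+
  moreover have "psubst l (psubst s Q) = psubst l' (psubst s' Q)"
    by (rule PIf.IH) (use PIf.prems in fastforce)+
  moreover have "msubst l (msubst s u) = msubst l' (msubst s' u)"
    "msubst l (msubst s v) = msubst l' (msubst s' v)"
    by (rule msubst_msubst_cong, rule PIf.prems(1), simp)+
  ultimately show ?case by simp
next
  case (PIn c z P)
  \<comment> \<open>Below the binder \<open>z\<close> both substitutions lose their entry for
    \<open>z\<close>. For the outer one this is harmless on inserted terms, since these do not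
    mention \<open>z\<close>.\<close>
  have upd: "msubst (k(z := None)) (msubst (t(z := None)) (Atom (Vrb v))) =
      (if v = z then Atom (Vrb z) else msubst k (msubst t (Atom (Vrb v))))"
    if "ran t \<subseteq> ran s \<union> ran s'" for k t v
  proof -
    have "msubst (k(z := None)) r = msubst k r" if "t v = Some r" for r
    proof (rule msubst_cong)
      fix x assume "x \<in> tvars r"
      moreover have "r \<in> ran s \<union> ran s'"
        using \<open>ran t \<subseteq> _\<close> that by (auto simp: ran_def)
      ultimately show "(k(z := None)) x = k x" using PIn.prems(2)[of r] by auto
    qed
    then show ?thesis by (auto split: option.splits)
  qed
  have "psubst (l(z := None)) (psubst (s(z := None)) P) =
      psubst (l'(z := None)) (psubst (s'(z := None)) P)"
  proof (rule PIn.IH)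
    fix v assume "v \<in> pfree P"
    then show "msubst (l(z := None)) (msubst (s(z := None)) (Atom (Vrb v))) =
        msubst (l'(z := None)) (msubst (s'(z := None)) (Atom (Vrb v)))"
      using PIn.prems(1)[of v] upd[of s l v] upd[of s' l' v] by auto
  next
    fix t assume "t \<in> ran (s(z := None)) \<union> ran (s'(z := None))"
    then have "t \<in> ran s \<union> ran s'" by (auto simp: ran_def split: if_splits)
    then show "tvars t \<inter> pvars P = {}" using PIn.prems(2)[of t] by auto
  qed
  then show ?case by simp
next
  case (POut c u P)
  have "psubst l (psubst s P) = psubst l' (psubst s' P)"
    by (rule POut.IH) (use POut.prems in fastforce)+
  moreover have "msubst l (msubst s u) = msubst l' (msubst s' u)"
    by (rule msubst_msubst_cong, rule POut.prems(1), simp)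
  ultimately show ?case by simp
qed simp

text \<open>This reconciles the two treatments of an input. Symbolically, \<open>y\<close> becomes
  the fresh \<open>x\<close>, which \<open>l\<close> later maps to \<open>r\<close>. Concretely,
  \<open>l\<close> is applied to the whole input process, where it skips the bound \<open>y\<close>,
  and the message \<open>r\<close> replaces \<open>y\<close> afterwards.\<close>

lemma psubst_fresh_input:
  assumes "x \<notin> pvars P" "l x = Some r" "\<And>t. t \<in> ran l \<Longrightarrow> tvars t = {}"
  shows "psubst l (psubst [y \<mapsto> Atom (Vrb x)] P) = psubst [y \<mapsto> r] (psubst (l(y := None)) P)"
proof (rule psubst_psubst_cong)
  fix v
  consider "v = y" | "v \<noteq> y" "l v = None" | t where "v \<noteq> y" "l v = Some t" by blast
  then show "msubst l (msubst [y \<mapsto> Atom (Vrb x)] (Atom (Vrb v))) =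
      msubst [y \<mapsto> r] (msubst (l(y := None)) (Atom (Vrb v)))"
  proof cases
    case (3 t)
    have "tvars t = {}" by (rule assms(3)) (rule ranI[of l v], fact)
    then have "msubst [y \<mapsto> r] t = t" by (simp add: msubst_fresh)
    with 3 show ?thesis by simp
  qed (simp_all add: assms(2))
next
  fix t assume "t \<in> ran [y \<mapsto> Atom (Vrb x)] \<union> ran (l(y := None))"
  then have "t = Atom (Vrb x) \<or> t \<in> ran l" by (auto simp: ran_def split: if_splits)
  then show "tvars t \<inter> pvars P = {}"
  proof
    assume "t \<in> ran l"
    then have "tvars t = {}" by (rule assms(3))
    then show ?thesis by simp
  qed (simp add: assms(1))
qed

lemma pfree_psubst: "pfree (psubst s P) \<subseteq> (pfree P - dom s) \<union> \<Union> (tvars ` ran s)"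
proof (induction P arbitrary: s)
  case (PIf u v P Q)
  define V where "V = \<Union> (tvars ` ran s)"
  have "tvars (msubst s u) \<subseteq> (tvars u - dom s) \<union> V" "tvars (msubst s v) \<subseteq> (tvars v - dom s) \<union> V"
    "pfree (psubst s P) \<subseteq> (pfree P - dom s) \<union> V" "pfree (psubst s Q) \<subseteq> (pfree Q - dom s) \<union> V"
    unfolding V_def by (rule tvars_msubst PIf)+
  then show ?case unfolding psubst.simps pfree.simps V_def[symmetric] by blast
next
  case (PIn c z P)
  define V where "V = \<Union> (tvars ` ran s)"
  have V: "\<Union> (tvars ` ran (s(z := None))) \<subseteq> V"
    unfolding V_def by (intro Union_mono image_mono) (auto simp: ran_def)
  have "pfree (psubst (s(z := None)) P) \<subseteq> (pfree P - dom (s(z := None))) \<union> \<Union> (tvars ` ran (s(z := None)))"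
    by (rule PIn)
  also have "\<dots> \<subseteq> (pfree P - (dom s - {z})) \<union> V"
    by (rule Un_mono[OF _ V]) simp
  finally show ?case unfolding psubst.simps pfree.simps V_def[symmetric] by blast
next
  case (POut c u P)
  define V where "V = \<Union> (tvars ` ran s)"
  have "tvars (msubst s u) \<subseteq> (tvars u - dom s) \<union> V"
    "pfree (psubst s P) \<subseteq> (pfree P - dom s) \<union> V"
    unfolding V_def by (rule tvars_msubst POut)+
  then show ?case unfolding psubst.simps pfree.simps V_def[symmetric] by blast
qed simp

lemma finite_pvars: "finite (pvars P)"
  by (induction P) (auto simp: finite_tvars)

section \<open>Evaluating recipes in frames, and instantiating frames\<close>

lemma rapply_cong:
  "R \<in> terms_over ar D \<Longrightarrow> (\<And>w. w \<in> D \<Longrightarrow> \<Phi> w = \<Psi> w) \<Longrightarrow> rapply \<Phi> R = rapply \<Psi> R"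
  unfolding rapply_def by (rule tbind_cong) (use terms_over_atoms in force)

lemma dom_frame_subst [simp]: "dom (frame_subst l \<Phi>) = dom \<Phi>"
  by (auto simp: frame_subst_def dom_def)

lemma frame_subst_apply: "frame_subst l \<Phi> w = map_option (msubst l) (\<Phi> w)"
  by (simp add: frame_subst_def)

lemma frame_subst_upd [simp]: "frame_subst l (\<Phi>(w \<mapsto> u)) = (frame_subst l \<Phi>)(w \<mapsto> msubst l u)"
  by (auto simp: frame_subst_def)

lemma frame_subst_cong: "(\<And>x. x \<in> frame_vars \<Phi> \<Longrightarrow> l x = l' x) \<Longrightarrow> frame_subst l \<Phi> = frame_subst l' \<Phi>"
proof
  fix w assume eq: "\<And>x. x \<in> frame_vars \<Phi> \<Longrightarrow> l x = l' x"
  show "frame_subst l \<Phi> w = frame_subst l' \<Phi> w"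
  proof (cases "\<Phi> w")
    case (Some t)
    then have "msubst l t = msubst l' t"
      by (intro msubst_cong eq) (auto simp: frame_vars_def ran_def)
    with Some show ?thesis by (simp add: frame_subst_apply)
  qed (simp add: frame_subst_apply)
qed

lemma frame_subst_empty [simp]: "frame_subst Map.empty \<Phi> = \<Phi>"
  by (auto simp: frame_subst_def fun_eq_iff option.map_ident_strong)

lemma frame_subst_closed: "frame_vars \<Phi> = {} \<Longrightarrow> frame_subst l \<Phi> = \<Phi>"
  using frame_subst_cong[of \<Phi> l Map.empty] by simp

lemma ran_frame_subst: "ran (frame_subst l \<Phi>) = msubst l ` ran \<Phi>"
  by (auto simp: ran_def frame_subst_apply)

lemma ran_upd_fresh: "w \<notin> dom \<Phi> \<Longrightarrow> ran (\<Phi>(w \<mapsto> u)) = insert u (ran \<Phi>)"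
  by (rule ran_map_upd) auto

lemma frame_vars_upd: "w \<notin> dom \<Phi> \<Longrightarrow> frame_vars (\<Phi>(w \<mapsto> u)) = frame_vars \<Phi> \<union> tvars u"
  by (simp add: frame_vars_def ran_upd_fresh Un_commute del: domIff)

lemma so_vars_empty [simp]: "so_vars {} = {}"
  by (auto simp: so_vars_def)

lemma so_vars_insert [simp]:
  "so_vars (insert (Ded D X x) S) = insert X (so_vars S)"
  "so_vars (insert (Equ u v) S) = so_vars S"
  "so_vars (insert (Neq u v) S) = so_vars S"
  by (auto simp: so_vars_def)

section \<open>Traces\<close>

fun inputs :: "('c, 'i, 'w) action list \<Rightarrow> 'i list" where
  "inputs [] = []"
| "inputs (In_act c X # tr) = X # inputs tr"
| "inputs (Out_act c w # tr) = inputs tr"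
| "inputs (Tau # tr) = inputs tr"

lemma inputs_append [simp]: "inputs (tr @ tr') = inputs tr @ inputs tr'"
  by (induction tr rule: inputs.induct) auto

abbreviation instantiate :: "('i \<rightharpoonup> 'r) \<Rightarrow> ('c, 'i, 'w) action \<Rightarrow> ('c, 'r, 'w) action" where
  "instantiate \<theta> \<equiv> map_action (\<lambda>c. c) (\<lambda>X. the (\<theta> X)) (\<lambda>w. w)"

lemma instantiate_cong:
  "(\<And>X. X \<in> set (inputs tr) \<Longrightarrow> \<theta> X = \<theta>' X) \<Longrightarrow> map (instantiate \<theta>) tr = map (instantiate \<theta>') tr"
  by (induction tr rule: inputs.induct) auto

lemma infinite_sovar: "infinite (UNIV :: sovar set)"
  by (metis infinite_UNIV_nat injI sovar.inject finite_imageD inj_on_subset rev_finite_subset subset_UNIV)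

lemma trace_lifting:
  obtains tr :: "('c, sovar, 'w) action list" and \<theta> :: "sovar \<rightharpoonup> 'r"
  where "map (instantiate \<theta>) tr = trc" "distinct (inputs tr)" "dom \<theta> = set (inputs tr)"
proof -
  have "\<exists>tr \<theta>. map (instantiate \<theta>) tr = trc \<and> distinct (inputs tr) \<and>
      dom (\<theta> :: sovar \<rightharpoonup> 'r) = set (inputs tr)"
  proof (induction trc)
    case Nil
    show ?case by (intro exI[of _ "[]"] exI[of _ Map.empty]) simp
  next
    case (Cons a trc)
    then obtain tr and \<theta> :: "sovar \<rightharpoonup> 'r"
      where IH: "map (instantiate \<theta>) tr = trc" "distinct (inputs tr)" "dom \<theta> = set (inputs tr)"
      by blast
    show ?case
    proof (cases a)
      case (In_act c R)
      obtain X where X: "X \<notin> set (inputs tr)"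
        using ex_new_if_finite[OF infinite_sovar] by blast
      have "map (instantiate (\<theta>(X \<mapsto> R))) tr = map (instantiate \<theta>) tr"
        by (rule instantiate_cong) (use X in auto)
      then have "map (instantiate (\<theta>(X \<mapsto> R))) (In_act c X # tr) = a # trc"
        by (simp only: IH(1) In_act list.map action.map fun_upd_same option.sel)
      moreover have "distinct (inputs (In_act c X # tr))"
        "dom (\<theta>(X \<mapsto> R)) = set (inputs (In_act c X # tr))"
        using IH(2,3) X by (simp_all del: domIff)
      ultimately show ?thesis
        by (intro exI[of _ "In_act c X # tr"] exI[of _ "\<theta>(X \<mapsto> R)"] conjI)
    next
      case (Out_act c w)
      with IH show ?thesis by (intro exI[of _ "Out_act c w # tr"] exI[of _ \<theta>]) auto
    next
      case Tau
      with IH show ?thesis by (intro exI[of _ "Tau # tr"] exI[of _ \<theta>]) auto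
    qed
  qed
  then show thesis using that by blast
qed

section \<open>Monotonicity of the symbolic semantics\<close>

lemma sym_step_mono: "sym_step P \<Phi> S a P' \<Phi>' S' \<Longrightarrow> S \<subseteq> S' \<and> \<Phi> \<subseteq>\<^sub>m \<Phi>'"
  by (induction rule: sym_step.induct) (auto simp: map_le_def)

text \<open>Constraints and frame entries are never lost, so a solution of the final system
  satisfies everything recorded at an intermediate state.\<close>

lemma sym_focus_mono: "sym_focus m P \<Phi> S tr r \<Phi>' S' \<Longrightarrow> S \<subseteq> S' \<and> \<Phi> \<subseteq>\<^sub>m \<Phi>'"
  by (induction rule: sym_focus.induct) (auto dest!: sym_step_mono intro: map_le_trans)

lemma sym_compressed_mono:
  "sym_compressed (\<P>, \<Phi>, S) tr (\<P>', \<Phi>', S') \<Longrightarrow> S \<subseteq> S' \<and> \<Phi> \<subseteq>\<^sub>m \<Phi>'"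
  by (induction "(\<P>, \<Phi>, S)" tr "(\<P>', \<Phi>', S')" arbitrary: \<P> \<Phi> S rule: sym_compressed.induct)
    (auto dest!: sym_focus_mono intro: map_le_trans)

lemma sym_step_inputs:
  "sym_step P \<Phi> S a P' \<Phi>' S' \<Longrightarrow> so_vars S' = so_vars S \<union> set (inputs [a]) \<and>
    set (inputs [a]) \<inter> so_vars S = {}"
  by (induction rule: sym_step.induct) auto

lemma sym_focus_inputs:
  "sym_focus m P \<Phi> S tr r \<Phi>' S' \<Longrightarrow> so_vars S' = so_vars S \<union> set (inputs tr) \<and>
    set (inputs tr) \<inter> so_vars S = {} \<and> distinct (inputs tr)"
  by (induction rule: sym_focus.induct) (auto dest!: sym_step_inputs)

text \<open>The second-order variables of the final system can be read off the trace. Two processes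
  with the same trace and no initial constraints thus impose the same domain on \<theta>.\<close>

lemma sym_compressed_inputs:
  "sym_compressed (\<P>, \<Phi>, S) tr (\<P>', \<Phi>', S') \<Longrightarrow> so_vars S' = so_vars S \<union> set (inputs tr) \<and>
    set (inputs tr) \<inter> so_vars S = {} \<and> distinct (inputs tr)"
  by (induction "(\<P>, \<Phi>, S)" tr "(\<P>', \<Phi>', S')" arbitrary: \<P> \<Phi> S rule: sym_compressed.induct)
    (auto dest!: sym_focus_inputs)

context term_model
begin

section \<open>Equality of messages with the same validity\<close>

lemma valid_ground: "valid u \<Longrightarrow> u \<in> terms_over ar (range Nam)"
  by (simp add: valid_def)

lemma E_refl: "t \<in> terms_over ar A \<Longrightarrow> (t, t) \<in> E"
  using E_equiv terms_over_UNIV by (fastforce simp: equiv_def refl_on_def)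

lemma E_sym: "(t, u) \<in> E \<Longrightarrow> (u, t) \<in> E"
  using E_equiv by (auto simp: equiv_def sym_def)

lemma E_trans: "(t, u) \<in> E \<Longrightarrow> (u, v) \<in> E \<Longrightarrow> (t, v) \<in> E"
  using E_equiv by (auto simp: equiv_def trans_def)

definition veq :: "('f, 'n, 'x) msg \<Rightarrow> ('f, 'n, 'x) msg \<Rightarrow> bool" where
  "veq t u \<longleftrightarrow> (t, u) \<in> E \<and> (valid t \<longleftrightarrow> valid u)"

lemma veq_sym: "veq t u \<Longrightarrow> veq u t"
  by (auto simp: veq_def E_sym)

lemma veq_trans: "veq t u \<Longrightarrow> veq u v \<Longrightarrow> veq t v"
  by (auto simp: veq_def intro: E_trans)

lemma veq_E: "veq t t' \<Longrightarrow> veq u u' \<Longrightarrow> (t, u) \<in> E \<longleftrightarrow> (t', u') \<in> E"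
  unfolding veq_def by (meson E_sym E_trans)

text \<open>Validity unfolds into validity of the arguments and one condition at the root, the only
  place where \<open>M\<close> enters. This shape suits inductions on terms.\<close>

lemma valid_App:
  assumes "length ts = ar f"
  shows "valid (App f ts) \<longleftrightarrow> (\<forall>t\<in>set ts. valid t) \<and> (\<exists>m\<in>M. (App f ts, m) \<in> E)"
proof -
  have "App f ts \<in> terms_over ar A \<longleftrightarrow> (\<forall>t\<in>set ts. t \<in> terms_over ar A)" for A
    using assms by (auto elim: terms_over.cases intro: terms_over.intros)
  then show ?thesis by (auto simp: valid_def)
qed

text \<open>At an application, \<open>E_cong\<close> relates the two instances; being
  \<open>E\<close>-equal to some element of \<open>M\<close> is then shared by transitivity, and the
  arguments have equal validity by induction.\<close>

lemma veq_tbind: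
  assumes "t \<in> terms_over ar A" "\<And>a. a \<in> atoms t \<Longrightarrow> veq (s a) (s' a)"
  shows "veq (tbind s t) (tbind s' t)"
  using assms
proof (induction rule: terms_over.induct)
  case (2 ts f)
  have veq: "veq (tbind s t) (tbind s' t)" if "t \<in> set ts" for t
    using 2 that by auto
  have "(App f (map (tbind s) ts), App f (map (tbind s') ts)) \<in> E"
    using 2(1) veq by (intro E_cong) (auto simp: list_all2_conv_all_nth veq_def)
  moreover from this have "(\<exists>m\<in>M. (App f (map (tbind s) ts), m) \<in> E) \<longleftrightarrow>
      (\<exists>m\<in>M. (App f (map (tbind s') ts), m) \<in> E)"
    by (meson E_sym E_trans)
  ultimately show ?case
    using 2(1) veq by (auto simp: veq_def valid_App)
qed auto

lemma veq_msubst: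
  assumes "t \<in> terms_over ar UNIV"
    and "\<And>x. x \<in> tvars t \<Longrightarrow> \<exists>u v. l x = Some u \<and> l' x = Some v \<and> veq u v"
  shows "veq (msubst l t) (msubst l' t)"
  unfolding msubst_def
proof (rule veq_tbind[OF assms(1)])
  fix a assume "a \<in> atoms t"
  with assms(2) show "veq (atom_subst l a) (atom_subst l' a)"
    by (cases a) (fastforce simp: veq_def intro: E_refl terms_over.intros dest: tvars_atom)+
qed

lemma veq_rapply:
  assumes "R \<in> terms_over ar D" "\<And>w. w \<in> D \<Longrightarrow> veq (the (\<Phi> w)) (the (\<Psi> w))"
  shows "veq (rapply \<Phi> R) (rapply \<Psi> R)"
  unfolding rapply_def
  by (rule veq_tbind[OF assms(1)]) (use assms terms_over_atoms in force)

definition frame_veq :: "('f, 'n, 'x, 'w) frame \<Rightarrow> ('f, 'n, 'x, 'w) frame \<Rightarrow> bool" where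
  "frame_veq \<Phi> \<Psi> \<longleftrightarrow> dom \<Phi> = dom \<Psi> \<and> (\<forall>w\<in>dom \<Phi>. veq (the (\<Phi> w)) (the (\<Psi> w)))"

lemma frame_veq_sym: "frame_veq \<Phi> \<Psi> \<Longrightarrow> frame_veq \<Psi> \<Phi>"
  by (auto simp: frame_veq_def veq_sym)

text \<open>Each recipe yields \<open>veq\<close> messages in the two frames, and static equivalence
  tests only validity and \<open>E\<close>-equality of such messages.\<close>

lemma static_equiv_frame_veq: "frame_veq \<Phi> \<Psi> \<Longrightarrow> static_equiv \<Phi> \<Psi>"
proof -
  assume *: "frame_veq \<Phi> \<Psi>"
  have "veq (rapply \<Phi> R) (rapply \<Psi> R)" if "R \<in> terms_over ar (dom \<Phi>)" for R
    using * by (intro veq_rapply[OF that]) (auto simp: frame_veq_def)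
  with * show ?thesis
    unfolding static_equiv_def by (auto simp: frame_veq_def veq_def veq_E)
qed

lemma static_equiv_trans: "static_equiv \<Phi> \<Psi> \<Longrightarrow> static_equiv \<Psi> \<Omega> \<Longrightarrow> static_equiv \<Phi> \<Omega>"
  unfolding static_equiv_def by auto

section \<open>Well-formed constraint systems and canonical solutions\<close>

text \<open>The derivation records the order in which a system was generated, an order that the
  constraint set itself forgets. Each deduction constraint introduces a new variable and uses the
  handles present at that moment; outputs and tests mention only variables already
  introduced.\<close>

inductive wf_csys :: "('f, 'n, 'x, 'w) frame \<Rightarrow> ('f, 'n, 'x, 'w) constr set \<Rightarrow> bool" where
  wf_init: "frame_vars \<Phi> = {} \<Longrightarrow> ran \<Phi> \<subseteq> terms_over ar UNIV \<Longrightarrow> wf_csys \<Phi> {}"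
| wf_ded: "wf_csys \<Phi> S \<Longrightarrow> x \<notin> csys_vars (\<Phi>, S) \<Longrightarrow> wf_csys \<Phi> (insert (Ded (dom \<Phi>) X x) S)"
| wf_out: "wf_csys \<Phi> S \<Longrightarrow> w \<notin> dom \<Phi> \<Longrightarrow> u \<in> terms_over ar UNIV \<Longrightarrow> tvars u \<subseteq> csys_vars (\<Phi>, S) \<Longrightarrow>
    wf_csys (\<Phi>(w \<mapsto> u)) S"
| wf_equ: "wf_csys \<Phi> S \<Longrightarrow> u \<in> terms_over ar UNIV \<Longrightarrow> v \<in> terms_over ar UNIV \<Longrightarrow>
    tvars u \<union> tvars v \<subseteq> csys_vars (\<Phi>, S) \<Longrightarrow> wf_csys \<Phi> (insert (Equ u v) S)"
| wf_neq: "wf_csys \<Phi> S \<Longrightarrow> u \<in> terms_over ar UNIV \<Longrightarrow> v \<in> terms_over ar UNIV \<Longrightarrow>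
    tvars u \<union> tvars v \<subseteq> csys_vars (\<Phi>, S) \<Longrightarrow> wf_csys \<Phi> (insert (Neq u v) S)"

lemma wf_csys_terms:
  assumes "wf_csys \<Phi> S"
  shows "ran \<Phi> \<subseteq> terms_over ar UNIV"
    and "\<And>u v. Equ u v \<in> S \<or> Neq u v \<in> S \<Longrightarrow> u \<in> terms_over ar UNIV \<and> v \<in> terms_over ar UNIV"
    and "\<And>D X x. Ded D X x \<in> S \<Longrightarrow> D \<subseteq> dom \<Phi>"
    and "finite (csys_vars (\<Phi>, S))"
proof -
  show "ran \<Phi> \<subseteq> terms_over ar UNIV"
    using assms by induction (simp_all add: ran_upd_fresh del: domIff fun_upd_apply)
  show "u \<in> terms_over ar UNIV \<and> v \<in> terms_over ar UNIV" if "Equ u v \<in> S \<or> Neq u v \<in> S" for u v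
    using assms that by induction auto
  show "D \<subseteq> dom \<Phi>" if "Ded D X x \<in> S" for D X x
    using assms that by induction (simp_all del: fun_upd_apply, blast+)
  show "finite (csys_vars (\<Phi>, S))"
    using assms by induction (simp_all add: frame_vars_upd finite_tvars del: domIff fun_upd_apply)
qed

lemma constr_vars_csys: "k \<in> S \<Longrightarrow> constr_vars k \<subseteq> csys_vars (\<Phi>, S)"
  by auto

lemma tvars_frame: "\<Phi> w = Some u \<Longrightarrow> tvars u \<subseteq> csys_vars (\<Phi>, S)"
  by (auto simp: frame_vars_def ran_def)

text \<open>
  The canonical instance of a choice of recipes maps each input variable to exactly the message
  computed by its recipe, not just to an \<open>E\<close>-equal one. It is the one that the concrete semantics uses.
\<close>

definition canonical :: "(sovar \<rightharpoonup> ('f, 'w) recipe) \<Rightarrow> ('f, 'n, 'x, 'w) frame \<Rightarrow>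
    ('f, 'n, 'x, 'w) constr set \<Rightarrow> ('x \<rightharpoonup> ('f, 'n, 'x) msg) \<Rightarrow> bool" where
  "canonical \<theta> \<Phi> S l \<longleftrightarrow> dom l = csys_vars (\<Phi>, S) \<and> ran l \<subseteq> terms_over ar (range Nam) \<and>
     (\<forall>D X x. Ded D X x \<in> S \<longrightarrow> the (\<theta> X) \<in> terms_over ar D \<and>
        l x = Some (rapply (frame_subst l \<Phi>) (the (\<theta> X))))"

text \<open>These are the conditions of \<open>assoc_subst\<close> that remain to be checked for a
  canonical substitution, whose deduction equalities hold syntactically.\<close>

definition sat :: "('f, 'n, 'x, 'w) frame \<Rightarrow> ('f, 'n, 'x, 'w) constr set \<Rightarrow>
    ('x \<rightharpoonup> ('f, 'n, 'x) msg) \<Rightarrow> bool" where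
  "sat \<Phi> S l \<longleftrightarrow>
     (\<forall>D X x. Ded D X x \<in> S \<longrightarrow> valid (the (l x))) \<and>
     (\<forall>u v. Equ u v \<in> S \<longrightarrow>
        (msubst l u, msubst l v) \<in> E \<and> valid (msubst l u) \<and> valid (msubst l v)) \<and>
     (\<forall>u v. Neq u v \<in> S \<longrightarrow>
        (msubst l u, msubst l v) \<notin> E \<or> \<not> valid (msubst l u) \<or> \<not> valid (msubst l v)) \<and>
     (\<forall>u\<in>ran \<Phi>. valid (msubst l u))"

lemma canonical_assoc_subst:
  "canonical \<theta> \<Phi> S l \<Longrightarrow> assoc_subst (\<Phi>, S) \<theta> l \<longleftrightarrow> sat \<Phi> S l"
proof -
  assume can: "canonical \<theta> \<Phi> S l"
  have ded: "(let u = rapply (frame_subst l \<Phi>) (the (\<theta> X)); v = msubst l (Atom (Vrb x))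
      in (u, v) \<in> E \<and> valid u \<and> valid v) \<longleftrightarrow> valid (the (l x))" if "Ded D X x \<in> S" for D X x
  proof -
    have lx: "l x = Some (rapply (frame_subst l \<Phi>) (the (\<theta> X)))" (is "_ = Some ?r")
      using can that by (auto simp: canonical_def)
    then have "?r \<in> terms_over ar (range Nam)"
      using can by (auto simp: canonical_def intro: ranI)
    then have "(?r, ?r) \<in> E" by (rule E_refl)
    with lx show ?thesis by (simp add: Let_def)
  qed
  then have "(\<forall>D X x. Ded D X x \<in> S \<longrightarrow>
      (let u = rapply (frame_subst l \<Phi>) (the (\<theta> X)); v = msubst l (Atom (Vrb x))
       in (u, v) \<in> E \<and> valid u \<and> valid v)) \<longleftrightarrow>
    (\<forall>D X x. Ded D X x \<in> S \<longrightarrow> valid (the (l x)))"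
    by blast
  moreover have "dom l = csys_vars (\<Phi>, S)" "ran l \<subseteq> terms_over ar (range Nam)"
    using can by (auto simp: canonical_def)
  ultimately show ?thesis
    unfolding assoc_subst_def sat_def ran_frame_subst prod.case ball_simps by blast
qed

section \<open>Extending canonical substitutions along the generation of the system\<close>

lemma frame_subst_ground:
  assumes "ran \<Phi> \<subseteq> terms_over ar UNIV" "frame_vars \<Phi> \<subseteq> dom l" "ran l \<subseteq> terms_over ar (range Nam)"
  shows "ran (frame_subst l \<Phi>) \<subseteq> terms_over ar (range Nam)"
  unfolding ran_frame_subst
proof safe
  fix t assume "t \<in> ran \<Phi>"
  with assms show "msubst l t \<in> terms_over ar (range Nam)"
    by (intro msubst_ground) (auto simp: frame_vars_def)
qed

lemma rapply_ground:
  assumes "R \<in> terms_over ar (dom \<Phi>)" "ran \<Phi> \<subseteq> terms_over ar B"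
  shows "rapply \<Phi> R \<in> terms_over ar B"
  unfolding rapply_def
proof (rule tbind_terms_over[OF assms(1)])
  fix w assume "w \<in> atoms R"
  then have "w \<in> dom \<Phi>" using terms_over_atoms[OF assms(1)] by auto
  then show "the (\<Phi> w) \<in> terms_over ar B" using assms(2) by (auto simp: ran_def)
qed

lemma canonical_ded:
  assumes "wf_csys \<Phi> S" "canonical \<theta> \<Phi> S l" "x \<notin> csys_vars (\<Phi>, S)"
    and "the (\<theta> X) \<in> terms_over ar (dom \<Phi>)"
  shows "canonical \<theta> \<Phi> (insert (Ded (dom \<Phi>) X x) S)
    (l(x \<mapsto> rapply (frame_subst l \<Phi>) (the (\<theta> X))))" (is "canonical _ _ _ ?l")
proof -
  have l: "dom l = csys_vars (\<Phi>, S)" "ran l \<subseteq> terms_over ar (range Nam)"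
    using assms(2) by (auto simp: canonical_def)
  have same: "frame_subst ?l \<Phi> = frame_subst l \<Phi>"
    by (rule frame_subst_cong) (use assms(3) in auto)
  have "ran (frame_subst l \<Phi>) \<subseteq> terms_over ar (range Nam)"
    using wf_csys_terms(1)[OF assms(1)] l by (intro frame_subst_ground) auto
  then have "rapply (frame_subst l \<Phi>) (the (\<theta> X)) \<in> terms_over ar (range Nam)"
    using assms(4) by (intro rapply_ground) auto
  then have "ran ?l \<subseteq> terms_over ar (range Nam)"
    using l(2) by (auto simp: ran_def split: if_splits)
  \<comment> \<open>The entry of no earlier input variable is overwritten, so the old deduction
    constraints keep their exact values.\<close>
  moreover have "y \<noteq> x" if "Ded D Y y \<in> S" for D Y y
    using that assms(3) by force
  ultimately show ?thesis
    using assms(2,4) l(1) unfolding canonical_def same by auto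
qed

text \<open>Earlier recipes use only handles of the old frame, hence never the new \<open>w\<close>,
  and evaluate as before.\<close>

lemma canonical_out:
  assumes "wf_csys \<Phi> S" "canonical \<theta> \<Phi> S l" "w \<notin> dom \<Phi>" "tvars u \<subseteq> csys_vars (\<Phi>, S)"
  shows "canonical \<theta> (\<Phi>(w \<mapsto> u)) S l"
proof -
  have "csys_vars (\<Phi>(w \<mapsto> u), S) = csys_vars (\<Phi>, S)"
    using assms(3,4) by (auto simp: frame_vars_upd)
  moreover have "rapply (frame_subst l (\<Phi>(w \<mapsto> u))) (the (\<theta> X)) = rapply (frame_subst l \<Phi>) (the (\<theta> X))"
    if "Ded D X x \<in> S" for D X x
  proof (rule rapply_cong[where D = D])
    show "the (\<theta> X) \<in> terms_over ar D" using assms(2) that by (auto simp: canonical_def)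
  next
    fix w' assume "w' \<in> D"
    then have "w' \<noteq> w" using wf_csys_terms(3)[OF assms(1) that] assms(3) by auto
    then show "frame_subst l (\<Phi>(w \<mapsto> u)) w' = frame_subst l \<Phi> w'" by (simp add: frame_subst_apply)
  qed
  ultimately show ?thesis using assms(2) unfolding canonical_def by auto
qed

lemma canonical_test:
  assumes "canonical \<theta> \<Phi> S l" "tvars u \<union> tvars v \<subseteq> csys_vars (\<Phi>, S)"
  shows "canonical \<theta> \<Phi> (insert (Equ u v) S) l" "canonical \<theta> \<Phi> (insert (Neq u v) S) l"
proof -
  have "csys_vars (\<Phi>, insert (Equ u v) S) = csys_vars (\<Phi>, S)"
    "csys_vars (\<Phi>, insert (Neq u v) S) = csys_vars (\<Phi>, S)"
    using assms(2) by auto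
  with assms(1) show "canonical \<theta> \<Phi> (insert (Equ u v) S) l" "canonical \<theta> \<Phi> (insert (Neq u v) S) l"
    unfolding canonical_def by auto
qed

lemma canonical_tvars: "canonical \<theta> \<Phi> S l \<Longrightarrow> t \<in> ran l \<Longrightarrow> tvars t = {}"
  by (rule tvars_ground) (auto simp: canonical_def)

lemma canonical_exists:
  assumes "wf_csys \<Phi> S" "\<And>D X x. Ded D X x \<in> S \<Longrightarrow> the (\<theta> X) \<in> terms_over ar D"
  shows "\<exists>l. canonical \<theta> \<Phi> S l"
  using assms
proof (induction rule: wf_csys.induct)
  case (wf_init \<Phi>)
  then show ?case by (intro exI[of _ Map.empty]) (auto simp: canonical_def)
next
  case (wf_ded \<Phi> S x X)
  then show ?case by (meson canonical_ded insertCI)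
next
  case (wf_out \<Phi> S w u)
  then show ?case by (meson canonical_out)
next
  case (wf_equ \<Phi> S u v)
  then show ?case by (meson canonical_test insertCI)
next
  case (wf_neq \<Phi> S u v)
  then show ?case by (meson canonical_test insertCI)
qed

section \<open>Uniqueness of the associated substitution up to \<open>veq\<close>\<close>

text \<open>
  The frame \<open>\<Omega>\<close> is the final one: deduction constraints are interpreted there, although each only
  refers to the handles present when it was generated.
\<close>

lemma assoc_veq_canonical_aux:
  assumes "wf_csys \<Phi> S" "\<Phi> \<subseteq>\<^sub>m \<Omega>"
    and "\<And>D X x. Ded D X x \<in> S \<Longrightarrow> the (\<theta> X) \<in> terms_over ar D \<and>
      (\<exists>u v. l x = Some u \<and> l' x = Some v \<and> veq (rapply (frame_subst l \<Omega>) (the (\<theta> X))) u \<and>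
        veq (rapply (frame_subst l' \<Omega>) (the (\<theta> X))) v)"
    and "x \<in> csys_vars (\<Phi>, S)"
  shows "\<exists>u v. l x = Some u \<and> l' x = Some v \<and> veq u v"
  using assms
proof (induction arbitrary: x rule: wf_csys.induct)
  case (wf_ded \<Phi> S y X)
  have IH: "\<exists>u v. l z = Some u \<and> l' z = Some v \<and> veq u v" if "z \<in> csys_vars (\<Phi>, S)" for z
    by (rule wf_ded.IH[OF wf_ded.prems(1) _ that]) (use wf_ded.prems(2) in blast)
  show ?case
  proof (cases "x = y")
    case True
    from wf_ded.prems(2)[OF insertI1] True obtain u v
      where uv: "the (\<theta> X) \<in> terms_over ar (dom \<Phi>)" "l x = Some u" "l' x = Some v"
        "veq (rapply (frame_subst l \<Omega>) (the (\<theta> X))) u"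
        "veq (rapply (frame_subst l' \<Omega>) (the (\<theta> X))) v"
      by blast
    \<comment> \<open>The recipe of \<open>y\<close> reads only handles in
      \<open>dom \<Phi>\<close>. Their messages contain variables introduced before
      \<open>y\<close>, on which \<open>l\<close> and \<open>l'\<close> agree by the induction
      hypothesis.\<close>
    have "veq (rapply (frame_subst l \<Omega>) (the (\<theta> X))) (rapply (frame_subst l' \<Omega>) (the (\<theta> X)))"
    proof (rule veq_rapply[OF uv(1)])
      fix w assume w: "w \<in> dom \<Phi>"
      then obtain t where t: "\<Phi> w = Some t" by auto
      then have "\<Omega> w = Some t" using wf_ded.prems(1) w by (auto simp: map_le_def)
      moreover have "veq (msubst l t) (msubst l' t)"
      proof (rule veq_msubst)
        show "t \<in> terms_over ar UNIV"
          using wf_csys_terms(1)[OF wf_ded.hyps(1)] t by (auto simp: ran_def)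
      qed (use IH tvars_frame[of \<Phi>, OF t] in blast)
      ultimately show "veq (the (frame_subst l \<Omega> w)) (the (frame_subst l' \<Omega> w))"
        by (simp add: frame_subst_apply)
    qed
    then have "veq u v" using uv(4,5) by (meson veq_sym veq_trans)
    with uv show ?thesis by blast
  next
    case False
    with wf_ded.prems(3) show ?thesis by (intro IH) auto
  qed
next
  case (wf_out \<Phi> S w u)
  have "\<Phi> \<subseteq>\<^sub>m \<Omega>" using wf_out.prems(1) wf_out.hyps(2)
    by (auto simp: map_le_def split: if_splits)
  moreover have "x \<in> csys_vars (\<Phi>, S)"
    using wf_out.prems(3) wf_out.hyps(4) frame_vars_upd[OF wf_out.hyps(2), of u]
    unfolding csys_vars.simps by blast
  ultimately show ?case using wf_out.IH wf_out.prems(2) by blast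
next
  case (wf_equ \<Phi> S u v)
  then have "x \<in> csys_vars (\<Phi>, S)" by auto
  with wf_equ show ?case by blast
next
  case (wf_neq \<Phi> S u v)
  then have "x \<in> csys_vars (\<Phi>, S)" by auto
  with wf_neq show ?case by blast
qed simp

text \<open>The auxiliary lemma is used with the system's own frame as the final one. Its hypothesis
  holds for \<open>l\<close> because values are exactly the recipe results, and for
  \<open>l'\<close> because its deduction constraints hold modulo \<open>E\<close> with both sides
  valid.\<close>

lemma assoc_veq_canonical:
  assumes wf: "wf_csys \<Phi> S" and can: "canonical \<theta> \<Phi> S l" and as: "assoc_subst (\<Phi>, S) \<theta> l'"
    and "u \<in> terms_over ar UNIV" "tvars u \<subseteq> csys_vars (\<Phi>, S)"
  shows "veq (msubst l' u) (msubst l u)"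
proof (rule veq_msubst[OF assms(4)])
  fix x assume "x \<in> tvars u"
  show "\<exists>u v. l' x = Some u \<and> l x = Some v \<and> veq u v"
  proof (rule assoc_veq_canonical_aux[OF wf map_le_refl])
    fix D X x assume D: "Ded D X x \<in> S"
    then have R: "the (\<theta> X) \<in> terms_over ar D" and
      lx: "l x = Some (rapply (frame_subst l \<Phi>) (the (\<theta> X)))" (is "_ = Some ?r")
      using can by (auto simp: canonical_def)
    have "?r \<in> ran l" using lx by (auto simp: ran_def)
    then have "veq ?r ?r" using can by (auto simp: canonical_def veq_def intro: E_refl)
    moreover have "x \<in> csys_vars (\<Phi>, S)" using D by force
    then have "x \<in> dom l'" using as unfolding assoc_subst_def prod.case by blast
    then obtain v where v: "l' x = Some v" by blast
    moreover have "veq (rapply (frame_subst l' \<Phi>) (the (\<theta> X))) (msubst l' (Atom (Vrb x)))"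
      using as D unfolding assoc_subst_def veq_def Let_def prod.case by blast
    then have "veq (rapply (frame_subst l' \<Phi>) (the (\<theta> X))) v" using v by simp
    ultimately show "the (\<theta> X) \<in> terms_over ar D \<and>
      (\<exists>u v. l' x = Some u \<and> l x = Some v \<and> veq (rapply (frame_subst l' \<Phi>) (the (\<theta> X))) u \<and>
        veq (rapply (frame_subst l \<Phi>) (the (\<theta> X))) v)"
      using R lx by auto
  qed (use \<open>x \<in> tvars u\<close> assms(5) in auto)
qed

lemma canonical_frame_veq:
  assumes "wf_csys \<Phi> S" "canonical \<theta> \<Phi> S l" "assoc_subst (\<Phi>, S) \<theta> l'"
  shows "frame_veq (frame_subst l' \<Phi>) (frame_subst l \<Phi>)"
proof -
  have "veq (msubst l' t) (msubst l t)" if "\<Phi> w = Some t" for w t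
    using wf_csys_terms(1)[OF assms(1)] that
    by (intro assoc_veq_canonical[OF assms] tvars_frame) (auto simp: ran_def)
  then show ?thesis by (auto simp: frame_veq_def frame_subst_apply)
qed

text \<open>All conditions are phrased through \<open>E\<close> and validity, both invariant under
  \<open>veq\<close>; they carry over from \<open>l'\<close> to \<open>l\<close>, negative ones
  included.\<close>

lemma canonical_sat:
  assumes "wf_csys \<Phi> S" "canonical \<theta> \<Phi> S l" "assoc_subst (\<Phi>, S) \<theta> l'"
  shows "sat \<Phi> S l"
proof -
  have ded: "valid (the (l x))" if "Ded D X x \<in> S" for D X x
  proof -
    have "x \<in> csys_vars (\<Phi>, S)" using that by force
    then have "veq (msubst l' (Atom (Vrb x))) (msubst l (Atom (Vrb x)))"
      by (intro assoc_veq_canonical[OF assms]) (auto intro: terms_over.intros)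
    moreover have "l x \<noteq> None" using assms(2) that unfolding canonical_def by blast
    moreover have "valid (msubst l' (Atom (Vrb x)))"
      using assms(3) that unfolding assoc_subst_def Let_def prod.case by blast
    ultimately show ?thesis by (auto simp: veq_def)
  qed
  have test: "veq (msubst l' u) (msubst l u) \<and> veq (msubst l' v) (msubst l v)"
    if "Equ u v \<in> S \<or> Neq u v \<in> S" for u v
    using wf_csys_terms(2)[OF assms(1) that] that
      constr_vars_csys[of "Equ u v" S \<Phi>] constr_vars_csys[of "Neq u v" S \<Phi>]
    by (intro conjI assoc_veq_canonical[OF assms]) auto
  have frame: "veq (msubst l' u) (msubst l u)" if "u \<in> ran \<Phi>" for u
    using wf_csys_terms(1)[OF assms(1)] that
    by (intro assoc_veq_canonical[OF assms]) (auto simp: frame_vars_def)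
  have sol: "Equ u v \<in> S \<Longrightarrow>
      (msubst l' u, msubst l' v) \<in> E \<and> valid (msubst l' u) \<and> valid (msubst l' v)"
    "Neq u v \<in> S \<Longrightarrow>
      (msubst l' u, msubst l' v) \<notin> E \<or> \<not> valid (msubst l' u) \<or> \<not> valid (msubst l' v)"
    "t \<in> ran \<Phi> \<Longrightarrow> valid (msubst l' t)" for u v t
    using assms(3) by (auto simp: assoc_subst_def ran_frame_subst)
  show ?thesis
    unfolding sat_def
  proof (intro conjI allI impI ballI)
    fix u v assume *: "Equ u v \<in> S"
    with test[of u v] sol(1)[OF *] show "(msubst l u, msubst l v) \<in> E"
      "valid (msubst l u)" "valid (msubst l v)"
      using veq_E by (auto simp: veq_def)
  next
    fix u v assume *: "Neq u v \<in> S"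
    with test[of u v] sol(2)[OF *]
    show "(msubst l u, msubst l v) \<notin> E \<or> \<not> valid (msubst l u) \<or> \<not> valid (msubst l v)"
      using veq_E by (auto simp: veq_def)
  next
    fix u assume *: "u \<in> ran \<Phi>"
    with frame[OF *] sol(3)[OF *] show "valid (msubst l u)" by (simp add: veq_def)
  qed (use ded in blast)
qed

lemma Sol_canonical:
  assumes "wf_csys \<Phi> S" "\<theta> \<in> Sol (\<Phi>, S)"
  obtains l where "canonical \<theta> \<Phi> S l" "sat \<Phi> S l"
proof -
  obtain l' where "assoc_subst (\<Phi>, S) \<theta> l'"
    using assms(2) by (auto simp: Sol_def)
  moreover obtain l where "canonical \<theta> \<Phi> S l"
    using canonical_exists[OF assms(1)] assms(2) unfolding Sol_def by blast
  ultimately show thesis using that canonical_sat assms(1) by blast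
qed

lemma canonical_Sol:
  "canonical \<theta> \<Phi> S l \<Longrightarrow> sat \<Phi> S l \<Longrightarrow> dom \<theta> = so_vars S \<Longrightarrow> \<theta> \<in> Sol (\<Phi>, S)"
  using canonical_assoc_subst[of \<theta> \<Phi> S l] by (auto simp: Sol_def canonical_def)

text \<open>Nothing is known about the representative chosen by \<open>fo_subst\<close> except that
  it is associated to \<theta>. The canonical \<open>l\<close> witnesses that such a substitution
  exists, and uniqueness does the rest.\<close>

lemma fo_subst_frame_veq:
  assumes "wf_csys \<Phi> S" "canonical \<theta> \<Phi> S l" "sat \<Phi> S l"
  shows "frame_veq (frame_subst (fo_subst (\<Phi>, S) \<theta>) \<Phi>) (frame_subst l \<Phi>)"
proof (rule canonical_frame_veq[OF assms(1,2)])
  show "assoc_subst (\<Phi>, S) \<theta> (fo_subst (\<Phi>, S) \<theta>)"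
    unfolding fo_subst_def
    by (rule someI[where x = l]) (simp add: canonical_assoc_subst[OF assms(2)] assms(3))
qed

section \<open>Invariants of symbolic executions\<close>

text \<open>The condition on \<open>pfree\<close> says that free variables of a running process stem
  from the generated system; a canonical substitution, defined on all variables of the system,
  therefore closes the process.\<close>

definition wf_proc :: "('f, 'n, 'x, 'c) proc \<Rightarrow> ('f, 'n, 'x, 'w) frame \<Rightarrow>
    ('f, 'n, 'x, 'w) constr set \<Rightarrow> bool" where
  "wf_proc P \<Phi> S \<longleftrightarrow> (\<exists>c. basic_process c P) \<and> pfree P \<subseteq> csys_vars (\<Phi>, S)"

lemma basic_process_psubst:
  "basic_process c P \<Longrightarrow> ran s \<subseteq> terms_over ar UNIV \<Longrightarrow> basic_process c (psubst s P)"
proof (induction P arbitrary: s)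
  case (PIn d x P)
  have "ran (s(x := None)) \<subseteq> ran s" by (auto simp: ran_def)
  with PIn show ?case by auto
qed (auto intro: msubst_terms_over)

lemma sym_step_wf:
  assumes "sym_step P \<Phi> S a P' \<Phi>' S'" "wf_csys \<Phi> S" "wf_proc P \<Phi> S"
  shows "wf_csys \<Phi>' S' \<and> wf_proc P' \<Phi>' S'"
  using assms
proof (induction rule: sym_step.induct)
  case (sym_in X S x \<Phi> c y P)
  have "wf_csys \<Phi> (insert (Ded (dom \<Phi>) X x) S)"
    using sym_in by (intro wf_ded) auto
  moreover obtain d where "basic_process d P" using sym_in by (auto simp: wf_proc_def)
  then have "basic_process d (psubst [y \<mapsto> Atom (Vrb x)] P)"
    by (rule basic_process_psubst) (auto intro: terms_over.intros)
  moreover have "pfree (psubst [y \<mapsto> Atom (Vrb x)] P) \<subseteq> csys_vars (\<Phi>, insert (Ded (dom \<Phi>) X x) S)"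
    (is "?l \<subseteq> _")
  proof -
    have "?l \<subseteq> (pfree P - {y}) \<union> {x}"
      using pfree_psubst[of "[y \<mapsto> Atom (Vrb x)]" P] by simp
    also have "\<dots> \<subseteq> csys_vars (\<Phi>, S) \<union> {x}"
      using sym_in.prems(2) unfolding wf_proc_def pfree.simps by blast
    also have "\<dots> \<subseteq> csys_vars (\<Phi>, insert (Ded (dom \<Phi>) X x) S)" by auto
    finally show ?thesis .
  qed
  ultimately show ?case unfolding wf_proc_def by blast
next
  case (sym_out w \<Phi> c u P S)
  then have u: "u \<in> terms_over ar UNIV" "tvars u \<subseteq> csys_vars (\<Phi>, S)"
    and P: "\<exists>d. basic_process d P" "pfree P \<subseteq> csys_vars (\<Phi>, S)"
    unfolding wf_proc_def by auto
  have "csys_vars (\<Phi>, S) \<subseteq> csys_vars (\<Phi>(w \<mapsto> u), S)"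
    using frame_vars_upd[OF sym_out.hyps] by auto
  with P have "wf_proc P (\<Phi>(w \<mapsto> u)) S" unfolding wf_proc_def by blast
  with wf_out[OF sym_out.prems(1) sym_out.hyps u] show ?case by blast
next
  case (sym_then u v P Q \<Phi> S)
  have vars: "csys_vars (\<Phi>, insert (Equ u v) S) = csys_vars (\<Phi>, S) \<union> (tvars u \<union> tvars v)" by auto
  show ?case
    using sym_then unfolding wf_proc_def vars basic_process.simps pfree.simps
    by (intro conjI wf_equ) blast+
next
  case (sym_else u v P Q \<Phi> S)
  have vars: "csys_vars (\<Phi>, insert (Neq u v) S) = csys_vars (\<Phi>, S) \<union> (tvars u \<union> tvars v)" by auto
  show ?case
    using sym_else unfolding wf_proc_def vars basic_process.simps pfree.simps
    by (intro conjI wf_neq) blast+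
qed

lemma csys_vars_mono: "S \<subseteq> S' \<Longrightarrow> \<Phi> \<subseteq>\<^sub>m \<Phi>' \<Longrightarrow> csys_vars (\<Phi>, S) \<subseteq> csys_vars (\<Phi>', S')"
proof -
  assume *: "S \<subseteq> S'" "\<Phi> \<subseteq>\<^sub>m \<Phi>'"
  then have "ran \<Phi> \<subseteq> ran \<Phi>'" by (force simp: ran_def map_le_def)
  with * show ?thesis by (auto simp: frame_vars_def)
qed

lemma wf_proc_mono: "wf_proc P \<Phi> S \<Longrightarrow> S \<subseteq> S' \<Longrightarrow> \<Phi> \<subseteq>\<^sub>m \<Phi>' \<Longrightarrow> wf_proc P \<Phi>' S'"
  using csys_vars_mono[of S S' \<Phi> \<Phi>'] unfolding wf_proc_def by blast

lemma wf_blocked: "wf_csys \<Phi> S \<Longrightarrow> wf_proc (POut c u P) \<Phi> S \<Longrightarrow> wf_csys \<Phi> (insert (Neq u u) S)"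
  by (intro wf_neq) (auto simp: wf_proc_def)

lemma sym_focus_wf:
  assumes "sym_focus m P \<Phi> S tr r \<Phi>' S'" "wf_csys \<Phi> S" "wf_proc P \<Phi> S"
  shows "wf_csys \<Phi>' S' \<and> (\<forall>P'. r = Some P' \<longrightarrow> wf_proc P' \<Phi>' S')"
  using assms
proof (induction rule: sym_focus.induct)
  case (sym_focus_in m P \<Phi> S c X P1 \<Phi>1 S1 tr r \<Phi>' S')
  from sym_step_wf[OF sym_focus_in.hyps(2) sym_focus_in.prems] sym_focus_in.IH show ?case by blast
next
  case (sym_focus_out m P \<Phi> S c w P1 \<Phi>1 S1 tr r \<Phi>' S')
  from sym_step_wf[OF sym_focus_out.hyps(2) sym_focus_out.prems] sym_focus_out.IH show ?case by blast
next
  case (sym_focus_tau P \<Phi> S P1 \<Phi>1 S1 m tr r \<Phi>' S')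
  from sym_step_wf[OF sym_focus_tau.hyps(1) sym_focus_tau.prems] sym_focus_tau.IH show ?case by blast
next
  case (sym_proper_blocked c u P \<Phi> S)
  have "wf_proc (POut c u P) \<Phi> (insert (Neq u u) S)"
    using sym_proper_blocked(2) by (rule wf_proc_mono) auto
  with wf_blocked[OF sym_proper_blocked] show ?case by blast
next
  case (sym_improper_blocked c u P \<Phi> S)
  from wf_blocked[OF this] show ?case by blast
qed blast+

lemma sym_compressed_wf:
  assumes "sym_compressed (\<P>, \<Phi>, S) tr (\<P>', \<Phi>', S')" "wf_csys \<Phi> S" "\<forall>P\<in>#\<P>. wf_proc P \<Phi> S"
  shows "wf_csys \<Phi>' S'"
  using assms
proof (induction "(\<P>, \<Phi>, S)" tr "(\<P>', \<Phi>', S')" arbitrary: \<P> \<Phi> S rule: sym_compressed.induct)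
  case (sym_comp_block P \<Phi> S tr P1 \<Phi>1 S1 \<Q> tr')
  have "wf_csys \<Phi>1 S1 \<and> wf_proc P1 \<Phi>1 S1"
    using sym_focus_wf sym_comp_block by fastforce
  moreover have "\<forall>Q\<in>#\<Q>. wf_proc Q \<Phi>1 S1"
  proof
    fix Q assume "Q \<in># \<Q>"
    then have "wf_proc Q \<Phi> S" using sym_comp_block.prems(2) by simp
    then show "wf_proc Q \<Phi>1 S1"
      using sym_focus_mono[OF sym_comp_block.hyps(1)] by (blast intro: wf_proc_mono)
  qed
  ultimately show ?case using sym_comp_block.hyps(3) by auto
next
  case (sym_comp_failure P \<Phi> S tr \<Phi>1 S1 tr' \<Q>)
  then show ?case using sym_focus_wf by fastforce
qed

section \<open>Soundness\<close>

text \<open>The pair \<Omega>, \<open>T\<close> is the final frame and constraint set. The single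
  \<open>l\<close> solving it instantiates every intermediate state, so no substitution has to be
  extended along the run.\<close>

lemma sym_step_sound:
  assumes "sym_step P \<Phi> S a P' \<Phi>' S'" "canonical \<theta> \<Omega> T l" "sat \<Omega> T l" "S' \<subseteq> T" "\<Phi>' \<subseteq>\<^sub>m \<Omega>"
  shows "step (psubst l P) (frame_subst l \<Phi>) (instantiate \<theta> a) (psubst l P') (frame_subst l \<Phi>')"
  using assms
proof (induction rule: sym_step.induct)
  case (sym_in X S x \<Phi> c y P)
  let ?R = "the (\<theta> X)" and ?r = "rapply (frame_subst l \<Phi>) (the (\<theta> X))"
  have D: "Ded (dom \<Phi>) X x \<in> T" using sym_in by auto
  then have R: "?R \<in> terms_over ar (dom \<Phi>)"
    and lx: "l x = Some (rapply (frame_subst l \<Omega>) ?R)"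
    using sym_in.prems(1) by (auto simp: canonical_def)
  \<comment> \<open>The canonical value of \<open>x\<close> is computed in the final frame, the
    concrete input in the current one; the recipe uses only handles on which the two agree.\<close>
  have r: "?r = rapply (frame_subst l \<Omega>) ?R"
    by (rule rapply_cong[OF R]) (use sym_in.prems(4) in \<open>auto simp: map_le_def frame_subst_apply\<close>)
  have v: "valid ?r" using D lx sym_in.prems(2) unfolding r sat_def by force
  have "psubst l (psubst [y \<mapsto> Atom (Vrb x)] P) = psubst [y \<mapsto> ?r] (psubst (l(y := None)) P)"
  proof (rule psubst_fresh_input)
    show "x \<notin> pvars P" using sym_in by auto
    show "l x = Some ?r" using lx r by simp
  qed (rule canonical_tvars[OF sym_in.prems(1)])
  with R v show ?case by (auto intro: step_in)
next
  case (sym_out w \<Phi> c u P S)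
  have "(\<Phi>(w \<mapsto> u)) w = \<Omega> w"
    using sym_out.prems(4) unfolding map_le_def by (rule bspec) simp
  then have "\<Omega> w = Some u" by simp
  then have "valid (msubst l u)" using sym_out.prems(2) by (auto simp: sat_def ran_def)
  then have "step (POut c (msubst l u) (psubst l P)) (frame_subst l \<Phi>) (Out_act c w)
      (psubst l P) ((frame_subst l \<Phi>)(w \<mapsto> msubst l u))"
    using sym_out.hyps by (intro step_out) simp_all
  then show ?case by (simp del: fun_upd_apply)
next
  case (sym_then u v P Q \<Phi> S)
  then show ?case by (auto simp: sat_def intro!: step_then)
next
  case (sym_else u v P Q \<Phi> S)
  then show ?case by (auto simp: sat_def intro!: step_else)
qed

text \<open>A valid instance of \<open>u\<close> would be ground and hence \<open>E\<close>-related
  to itself. The constraint \<open>Neq u u\<close> thus expresses exactly that the instance is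
  invalid.\<close>

lemma blocked_invalid: "sat \<Omega> T l \<Longrightarrow> Neq u u \<in> T \<Longrightarrow> \<not> valid (msubst l u)"
  using E_refl valid_ground unfolding sat_def by blast

lemma sym_focus_sound:
  assumes "sym_focus m P \<Phi> S tr r \<Phi>' S'" "canonical \<theta> \<Omega> T l" "sat \<Omega> T l" "S' \<subseteq> T" "\<Phi>' \<subseteq>\<^sub>m \<Omega>"
  shows "focus m (psubst l P) (frame_subst l \<Phi>) (map (instantiate \<theta>) tr)
    (map_option (psubst l) r) (frame_subst l \<Phi>')"
  using assms
proof (induction rule: sym_focus.induct)
  case (sym_focus_in m P \<Phi> S c X P1 \<Phi>1 S1 tr r \<Phi>' S')
  have "S1 \<subseteq> T" "\<Phi>1 \<subseteq>\<^sub>m \<Omega>"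
    using sym_focus_mono[OF sym_focus_in.hyps(3)] sym_focus_in.prems map_le_trans by blast+
  from sym_step_sound[OF sym_focus_in.hyps(2) sym_focus_in.prems(1,2) this]
  show ?case using sym_focus_in by (auto intro: focus_in)
next
  case (sym_focus_out m P \<Phi> S c w P1 \<Phi>1 S1 tr r \<Phi>' S')
  have "S1 \<subseteq> T" "\<Phi>1 \<subseteq>\<^sub>m \<Omega>"
    using sym_focus_mono[OF sym_focus_out.hyps(3)] sym_focus_out.prems map_le_trans by blast+
  from sym_step_sound[OF sym_focus_out.hyps(2) sym_focus_out.prems(1,2) this]
  show ?case using sym_focus_out by (auto intro: focus_out)
next
  case (sym_focus_tau P \<Phi> S P1 \<Phi>1 S1 m tr r \<Phi>' S')
  have "S1 \<subseteq> T" "\<Phi>1 \<subseteq>\<^sub>m \<Omega>"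
    using sym_focus_mono[OF sym_focus_tau.hyps(2)] sym_focus_tau.prems map_le_trans by blast+
  from sym_step_sound[OF sym_focus_tau.hyps(1) sym_focus_tau.prems(1,2) this]
  show ?case using sym_focus_tau by (auto intro: focus_tau)
qed (auto intro: focus.intros dest: blocked_invalid)

lemma sym_compressed_sound:
  assumes "sym_compressed (\<P>, \<Phi>, S) tr (\<P>', \<Phi>', S')" "canonical \<theta> \<Phi>' S' l" "sat \<Phi>' S' l"
  shows "compressed (image_mset (psubst l) \<P>, frame_subst l \<Phi>) (map (instantiate \<theta>) tr)
    (image_mset (psubst l) \<P>', frame_subst l \<Phi>')"
  using assms
proof (induction "(\<P>, \<Phi>, S)" tr "(\<P>', \<Phi>', S')" arbitrary: \<P> \<Phi> S rule: sym_compressed.induct)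
  case sym_comp_nil
  then show ?case by (auto intro: comp_nil)
next
  case (sym_comp_block P \<Phi> S tr P1 \<Phi>1 S1 \<Q> tr')
  have "S1 \<subseteq> S'" "\<Phi>1 \<subseteq>\<^sub>m \<Phi>'"
    using sym_compressed_mono[OF sym_comp_block.hyps(2)] by auto
  from sym_focus_sound[OF sym_comp_block.hyps(1) sym_comp_block.prems this]
  show ?case using sym_comp_block by (auto intro: comp_block)
next
  case (sym_comp_failure P \<Phi> S tr \<Phi>1 S1 tr' \<Q>)
  have "S1 \<subseteq> S'" "\<Phi>1 \<subseteq>\<^sub>m \<Phi>'"
    using sym_compressed_mono[OF sym_comp_failure.hyps(2)] by auto
  from sym_focus_sound[OF sym_comp_failure.hyps(1) sym_comp_failure.prems this]
  show ?case using sym_comp_failure by (auto intro: comp_failure)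
qed

section \<open>Completeness\<close>

lemma sat_ded:
  assumes "sat \<Phi> S l" "x \<notin> csys_vars (\<Phi>, S)" "valid r"
  shows "sat \<Phi> (insert (Ded D0 X x) S) (l(x \<mapsto> r))"
proof -
  have eq: "msubst (l(x \<mapsto> r)) t = msubst l t" if "tvars t \<subseteq> csys_vars (\<Phi>, S)" for t
    by (rule msubst_cong) (use that assms(2) in auto)
  have test: "msubst (l(x \<mapsto> r)) u = msubst l u \<and> msubst (l(x \<mapsto> r)) v = msubst l v"
    if "Equ u v \<in> S \<or> Neq u v \<in> S" for u v
    using constr_vars_csys[of "Equ u v" S \<Phi>] constr_vars_csys[of "Neq u v" S \<Phi>] that
    by (intro conjI eq) auto
  have frame: "msubst (l(x \<mapsto> r)) u = msubst l u" if "u \<in> ran \<Phi>" for u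
    by (rule eq) (use that in \<open>auto simp: frame_vars_def\<close>)
  show ?thesis
    unfolding sat_def
  proof (intro conjI allI impI ballI)
    fix D Y y assume "Ded D Y y \<in> insert (Ded D0 X x) S"
    then show "valid (the ((l(x \<mapsto> r)) y))" using assms(1,3) by (auto simp: sat_def)
  next
    fix u v assume "Equ u v \<in> insert (Ded D0 X x) S"
    then have *: "Equ u v \<in> S" by simp
    then have "msubst (l(x \<mapsto> r)) u = msubst l u" "msubst (l(x \<mapsto> r)) v = msubst l v"
      using test by blast+
    then show "(msubst (l(x \<mapsto> r)) u, msubst (l(x \<mapsto> r)) v) \<in> E"
      "valid (msubst (l(x \<mapsto> r)) u)" "valid (msubst (l(x \<mapsto> r)) v)"
      using assms(1) * by (auto simp: sat_def)
  next
    fix u v assume "Neq u v \<in> insert (Ded D0 X x) S"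
    then have *: "Neq u v \<in> S" by simp
    then have "msubst (l(x \<mapsto> r)) u = msubst l u" "msubst (l(x \<mapsto> r)) v = msubst l v"
      using test by blast+
    then show "(msubst (l(x \<mapsto> r)) u, msubst (l(x \<mapsto> r)) v) \<notin> E \<or>
        \<not> valid (msubst (l(x \<mapsto> r)) u) \<or> \<not> valid (msubst (l(x \<mapsto> r)) v)"
      using assms(1) * by (auto simp: sat_def)
  next
    fix u assume "u \<in> ran \<Phi>"
    with frame show "valid (msubst (l(x \<mapsto> r)) u)" using assms(1) by (auto simp: sat_def)
  qed
qed

text \<open>The concrete step starts from an instance of a symbolic state, so its process has the
  same head constructor as \<open>P\<close>. Only an input enlarges \<open>l\<close>, by the value
  of the fresh variable; a test or an output keeps \<open>l\<close> and records what the concrete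
  rule has checked.\<close>

lemma step_complete:
  assumes inf: "infinite (UNIV :: 'x set)"
    and step: "step (psubst l P) (frame_subst l \<Phi>) (instantiate \<theta> a) Pc \<Phi>c"
    and wf: "wf_csys \<Phi> S" "wf_proc P \<Phi> S"
    and sol: "canonical \<theta> \<Phi> S l" "sat \<Phi> S l"
    and fresh: "set (inputs [a]) \<inter> so_vars S = {}"
  shows "\<exists>P' \<Phi>' S' l'. sym_step P \<Phi> S a P' \<Phi>' S' \<and> canonical \<theta> \<Phi>' S' l' \<and> sat \<Phi>' S' l' \<and>
    l \<subseteq>\<^sub>m l' \<and> Pc = psubst l' P' \<and> \<Phi>c = frame_subst l' \<Phi>'"
  using step
proof cases
  case (step_in R c y P0)
  from step_in(2) obtain X where a: "a = In_act c X" "R = the (\<theta> X)" by (cases a) auto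
  from step_in(1) obtain P1 where P: "P = PIn c y P1" "P0 = psubst (l(y := None)) P1"
    by (cases P) auto
  \<comment> \<open>Infinitely many first-order variables exist, while the system and the process
    use only finitely many.\<close>
  obtain x where x: "x \<notin> csys_vars (\<Phi>, S) \<union> pvars P"
    using ex_new_if_finite[OF inf] wf_csys_terms(4)[OF wf(1)] finite_pvars finite_UnI by metis
  let ?r = "rapply (frame_subst l \<Phi>) R" and ?S = "insert (Ded (dom \<Phi>) X x) S"
  let ?l = "l(x \<mapsto> ?r)"
  have can: "canonical \<theta> \<Phi> ?S ?l"
    using step_in(5) x unfolding a(2) by (intro canonical_ded wf(1) sol(1)) auto
  have st: "sat \<Phi> ?S ?l" using sat_ded[OF sol(2)] x step_in(6) by blast
  have "x \<notin> dom l" using x sol(1) by (auto simp: canonical_def)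
  then have le: "l \<subseteq>\<^sub>m ?l" by (auto simp: map_le_def)
  have "psubst ?l (psubst [y \<mapsto> Atom (Vrb x)] P1) = psubst [y \<mapsto> ?r] (psubst (?l(y := None)) P1)"
  proof (rule psubst_fresh_input)
    show "x \<notin> pvars P1" using x P(1) by auto
  qed (simp, rule canonical_tvars[OF can])
  \<comment> \<open>The new entry at \<open>x\<close> is invisible here: a free variable of
    \<open>P1\<close> is either the deleted \<open>y\<close> or belongs to the system, which
    \<open>x\<close> avoids.\<close>
  moreover have "psubst (?l(y := None)) P1 = psubst (l(y := None)) P1"
  proof (rule psubst_cong)
    fix z assume "z \<in> pfree P1"
    then have "z = y \<or> z \<in> csys_vars (\<Phi>, S)" using wf(2) P(1) by (auto simp: wf_proc_def)
    then show "(?l(y := None)) z = (l(y := None)) z" using x by auto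
  qed
  ultimately have "Pc = psubst ?l (psubst [y \<mapsto> Atom (Vrb x)] P1)" using step_in(3) P(2) by simp
  moreover have "frame_subst ?l \<Phi> = frame_subst l \<Phi>"
    by (rule frame_subst_cong) (use x in auto)
  moreover have "sym_step P \<Phi> S a (psubst [y \<mapsto> Atom (Vrb x)] P1) \<Phi> ?S"
    unfolding P(1) a(1) by (rule sym_in) (use x P(1) fresh a(1) in auto)
  ultimately show ?thesis using can st le step_in(4) by metis
next
  case (step_out w u c)
  from step_out(2) have a: "a = Out_act c w" by (cases a) auto
  from step_out(1) obtain u' P' where P: "P = POut c u' P'" "u = msubst l u'" "Pc = psubst l P'"
    by (cases P) auto
  have "tvars u' \<subseteq> csys_vars (\<Phi>, S)" using wf(2) P(1) by (auto simp: wf_proc_def)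
  then have "canonical \<theta> (\<Phi>(w \<mapsto> u')) S l"
    using step_out(4) by (intro canonical_out wf(1) sol(1)) auto
  moreover have "sat (\<Phi>(w \<mapsto> u')) S l"
    using sol(2) step_out(4,5) P(2) ran_upd_fresh[of w \<Phi> u'] by (auto simp: sat_def)
  moreover have "sym_step P \<Phi> S a P' (\<Phi>(w \<mapsto> u')) S"
    using step_out(4) unfolding P(1) a by (auto intro: sym_out)
  ultimately show ?thesis using P step_out(3) by (metis map_le_refl frame_subst_upd)
next
  case (step_then u v Q)
  from step_then(2) have a: "a = Tau" by (cases a) auto
  from step_then(1) obtain u' v' P' Q'
    where P: "P = PIf u' v' P' Q'" "u = msubst l u'" "v = msubst l v'" "Pc = psubst l P'"
    by (cases P) auto
  have "canonical \<theta> \<Phi> (insert (Equ u' v') S) l"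
    using wf(2) P(1) by (intro canonical_test sol(1)) (auto simp: wf_proc_def)
  moreover have "sat \<Phi> (insert (Equ u' v') S) l"
    using sol(2) step_then P(2,3) by (auto simp: sat_def)
  moreover have "sym_step P \<Phi> S a P' \<Phi> (insert (Equ u' v') S)"
    unfolding P(1) a by (rule sym_then)
  ultimately show ?thesis using P step_then(3) by (metis map_le_refl)
next
  case (step_else u v P0)
  from step_else(2) have a: "a = Tau" by (cases a) auto
  from step_else(1) obtain u' v' P' Q'
    where P: "P = PIf u' v' P' Q'" "u = msubst l u'" "v = msubst l v'" "Pc = psubst l Q'"
    by (cases P) auto
  have "canonical \<theta> \<Phi> (insert (Neq u' v') S) l"
    using wf(2) P(1) by (intro canonical_test sol(1)) (auto simp: wf_proc_def)
  moreover have "sat \<Phi> (insert (Neq u' v') S) l"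
    using sol(2) step_else P(2,3) by (auto simp: sat_def)
  moreover have "sym_step P \<Phi> S a Q' \<Phi> (insert (Neq u' v') S)"
    unfolding P(1) a by (rule sym_else)
  ultimately show ?thesis using P step_else(3) by (metis map_le_refl)
qed

lemma blocked_sol:
  assumes "canonical \<theta> \<Phi> S l" "sat \<Phi> S l" "wf_proc (POut c u P) \<Phi> S" "\<not> valid (msubst l u)"
  shows "canonical \<theta> \<Phi> (insert (Neq u u) S) l \<and> sat \<Phi> (insert (Neq u u) S) l"
proof
  show "canonical \<theta> \<Phi> (insert (Neq u u) S) l"
    using assms(3) by (intro canonical_test assms(1)) (auto simp: wf_proc_def)
qed (use assms(2,4) in \<open>auto simp: sat_def\<close>)

text \<open>The concrete data are tied to instances by equations, so that induction on the concrete
  block can vary the symbolic state and \<open>l\<close>. The inclusion of \<open>l\<close> in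
  \<open>l'\<close> is exported for the sake of the basic processes outside the focus.\<close>

lemma focus_complete:
  assumes inf: "infinite (UNIV :: 'x set)"
    and "focus m Pc \<Phi>c trc rc \<Phi>c'"
    and "Pc = psubst l P" "\<Phi>c = frame_subst l \<Phi>" "trc = map (instantiate \<theta>) tr"
    and "wf_csys \<Phi> S" "wf_proc P \<Phi> S" "canonical \<theta> \<Phi> S l" "sat \<Phi> S l"
    and "set (inputs tr) \<inter> so_vars S = {}" "distinct (inputs tr)"
  shows "\<exists>r \<Phi>' S' l'. sym_focus m P \<Phi> S tr r \<Phi>' S' \<and> canonical \<theta> \<Phi>' S' l' \<and> sat \<Phi>' S' l' \<and>
    l \<subseteq>\<^sub>m l' \<and> rc = map_option (psubst l') r \<and> \<Phi>c' = frame_subst l' \<Phi>'"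
  using assms(2-)
proof (induction arbitrary: P \<Phi> S tr l rule: focus.induct)
  case (focus_in m Pc \<Phi>c c R Pc1 \<Phi>c1 trc rc \<Phi>c')
  from focus_in.prems(3) obtain X tr1
    where tr: "tr = In_act c X # tr1" "R = the (\<theta> X)" "trc = map (instantiate \<theta>) tr1"
    by (cases tr; cases "hd tr") auto
  have "step (psubst l P) (frame_subst l \<Phi>) (instantiate \<theta> (In_act c X)) Pc1 \<Phi>c1"
    using focus_in tr by auto
  from step_complete[OF inf this focus_in.prems(4-7)] obtain P1 \<Phi>1 S1 l1
    where s: "sym_step P \<Phi> S (In_act c X) P1 \<Phi>1 S1" "canonical \<theta> \<Phi>1 S1 l1" "sat \<Phi>1 S1 l1"
      "l \<subseteq>\<^sub>m l1" "Pc1 = psubst l1 P1" "\<Phi>c1 = frame_subst l1 \<Phi>1"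
    using focus_in.prems(8) tr(1) by auto
  have "set (inputs tr1) \<inter> so_vars S1 = {} \<and> distinct (inputs tr1)"
    using sym_step_inputs[OF s(1)] focus_in.prems(8,9) tr(1) by auto
  then obtain r \<Phi>' S' l' where r: "sym_focus In_Star P1 \<Phi>1 S1 tr1 r \<Phi>' S'" "canonical \<theta> \<Phi>' S' l'"
    "sat \<Phi>' S' l'" "l1 \<subseteq>\<^sub>m l'" "rc = map_option (psubst l') r" "\<Phi>c' = frame_subst l' \<Phi>'"
    using focus_in.IH[OF s(5,6) tr(3) _ _ s(2,3)] sym_step_wf[OF s(1) focus_in.prems(4,5)] by blast
  have "sym_focus m P \<Phi> S tr r \<Phi>' S'"
    unfolding tr(1) by (rule sym_focus_in[OF focus_in.hyps(1) s(1) r(1)])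
  with r(2-) show ?case using map_le_trans[OF s(4) r(4)] by blast
next
  case (focus_out m Pc \<Phi>c c w Pc1 \<Phi>c1 trc rc \<Phi>c')
  from focus_out.prems(3) obtain tr1
    where tr: "tr = Out_act c w # tr1" "trc = map (instantiate \<theta>) tr1"
    by (cases tr; cases "hd tr") auto
  have "step (psubst l P) (frame_subst l \<Phi>) (instantiate \<theta> (Out_act c w)) Pc1 \<Phi>c1"
    using focus_out tr by auto
  from step_complete[OF inf this focus_out.prems(4-7)] obtain P1 \<Phi>1 S1 l1
    where s: "sym_step P \<Phi> S (Out_act c w) P1 \<Phi>1 S1" "canonical \<theta> \<Phi>1 S1 l1" "sat \<Phi>1 S1 l1"
      "l \<subseteq>\<^sub>m l1" "Pc1 = psubst l1 P1" "\<Phi>c1 = frame_subst l1 \<Phi>1"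
    using focus_out.prems(8) tr(1) by auto
  have "set (inputs tr1) \<inter> so_vars S1 = {} \<and> distinct (inputs tr1)"
    using sym_step_inputs[OF s(1)] focus_out.prems(8,9) tr(1) by auto
  then obtain r \<Phi>' S' l' where r: "sym_focus Out_Star P1 \<Phi>1 S1 tr1 r \<Phi>' S'" "canonical \<theta> \<Phi>' S' l'"
    "sat \<Phi>' S' l'" "l1 \<subseteq>\<^sub>m l'" "rc = map_option (psubst l') r" "\<Phi>c' = frame_subst l' \<Phi>'"
    using focus_out.IH[OF s(5,6) tr(2) _ _ s(2,3)] sym_step_wf[OF s(1) focus_out.prems(4,5)] by blast
  have "sym_focus m P \<Phi> S tr r \<Phi>' S'"
    unfolding tr(1) by (rule sym_focus_out[OF focus_out.hyps(1) s(1) r(1)])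
  with r(2-) show ?case using map_le_trans[OF s(4) r(4)] by blast
next
  case (focus_tau Pc \<Phi>c Pc1 \<Phi>c1 m trc rc \<Phi>c')
  have "step (psubst l P) (frame_subst l \<Phi>) (instantiate \<theta> Tau) Pc1 \<Phi>c1"
    using focus_tau by auto
  from step_complete[OF inf this focus_tau.prems(4-7)] obtain P1 \<Phi>1 S1 l1
    where s: "sym_step P \<Phi> S Tau P1 \<Phi>1 S1" "canonical \<theta> \<Phi>1 S1 l1" "sat \<Phi>1 S1 l1"
      "l \<subseteq>\<^sub>m l1" "Pc1 = psubst l1 P1" "\<Phi>c1 = frame_subst l1 \<Phi>1"
    by auto
  have "set (inputs tr) \<inter> so_vars S1 = {} \<and> distinct (inputs tr)"
    using sym_step_inputs[OF s(1)] focus_tau.prems(8,9) by auto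
  then obtain r \<Phi>' S' l' where r: "sym_focus m P1 \<Phi>1 S1 tr r \<Phi>' S'" "canonical \<theta> \<Phi>' S' l'"
    "sat \<Phi>' S' l'" "l1 \<subseteq>\<^sub>m l'" "rc = map_option (psubst l') r" "\<Phi>c' = frame_subst l' \<Phi>'"
    using focus_tau.IH[OF s(5,6) focus_tau.prems(3) _ _ s(2,3)]
      sym_step_wf[OF s(1) focus_tau.prems(4,5)] by blast
  have "sym_focus m P \<Phi> S tr r \<Phi>' S'"
    by (rule sym_focus_tau[OF s(1) r(1)])
  with r(2-) show ?case using map_le_trans[OF s(4) r(4)] by blast
next
  case (proper_null \<Phi>c)
  then have "P = PNull" by (cases P) auto
  with proper_null have "sym_focus Out_Star P \<Phi> S tr (Some P) \<Phi> S"
    by (auto intro: sym_proper_null)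
  with proper_null show ?case
    by (intro exI[of _ "Some P"] exI[of _ \<Phi>] exI[of _ S] exI[of _ l]) auto
next
  case (proper_in c x Pc \<Phi>c)
  then obtain P1 where "P = PIn c x P1" by (cases P) auto
  with proper_in have "sym_focus Out_Star P \<Phi> S tr (Some P) \<Phi> S"
    by (auto intro: sym_proper_in)
  with proper_in show ?case
    by (intro exI[of _ "Some P"] exI[of _ \<Phi>] exI[of _ S] exI[of _ l]) auto
next
  case (proper_blocked u c Pc \<Phi>c)
  then obtain u' P1 where P: "P = POut c u' P1" "u = msubst l u'" by (cases P) auto
  with proper_blocked have "sym_focus Out_Star P \<Phi> S tr (Some P) \<Phi> (insert (Neq u' u') S)"
    by (auto intro: sym_proper_blocked)
  with proper_blocked P show ?case
    using blocked_sol[of \<theta> \<Phi> S l c u' P1]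
    by (intro exI[of _ "Some P"] exI[of _ \<Phi>] exI[of _ "insert (Neq u' u') S"] exI[of _ l]) auto
next
  case (improper_null \<Phi>c)
  then have "P = PNull" by (cases P) auto
  with improper_null have "sym_focus In_Star P \<Phi> S tr None \<Phi> S"
    by (auto intro: sym_improper_null)
  with improper_null show ?case
    by (intro exI[of _ None] exI[of _ \<Phi>] exI[of _ S] exI[of _ l]) auto
next
  case (improper_blocked u c Pc \<Phi>c)
  then obtain u' P1 where P: "P = POut c u' P1" "u = msubst l u'" by (cases P) auto
  with improper_blocked have "sym_focus In_Star P \<Phi> S tr None \<Phi> (insert (Neq u' u') S)"
    by (auto intro: sym_improper_blocked)
  with improper_blocked P show ?case
    using blocked_sol[of \<theta> \<Phi> S l c u' P1]
    by (intro exI[of _ None] exI[of _ \<Phi>] exI[of _ "insert (Neq u' u') S"] exI[of _ l]) auto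
qed

text \<open>A canonical \<open>l\<close> is already defined on every free variable of
  \<open>P\<close>, so entries added later cannot change the instance.\<close>

lemma psubst_extend:
  assumes "wf_proc P \<Phi> S" "canonical \<theta> \<Phi> S l" "l \<subseteq>\<^sub>m l'"
  shows "psubst l P = psubst l' P"
proof (rule psubst_cong)
  fix x assume "x \<in> pfree P"
  then have "x \<in> dom l" using assms(1,2) unfolding wf_proc_def canonical_def by blast
  then show "l x = l' x" using assms(3) unfolding map_le_def by blast
qed

lemma compressed_complete:
  assumes inf: "infinite (UNIV :: 'x set)"
    and "compressed (\<P>c, \<Phi>c) trc (\<P>c', \<Phi>c')"
    and "\<P>c = image_mset (psubst l) \<P>" "\<Phi>c = frame_subst l \<Phi>" "trc = map (instantiate \<theta>) tr"
    and "wf_csys \<Phi> S" "\<forall>P\<in>#\<P>. wf_proc P \<Phi> S" "canonical \<theta> \<Phi> S l" "sat \<Phi> S l"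
    and "set (inputs tr) \<inter> so_vars S = {}" "distinct (inputs tr)"
  shows "\<exists>\<P>' \<Phi>' S' l'. sym_compressed (\<P>, \<Phi>, S) tr (\<P>', \<Phi>', S') \<and>
    canonical \<theta> \<Phi>' S' l' \<and> sat \<Phi>' S' l' \<and> \<Phi>c' = frame_subst l' \<Phi>'"
  using assms(2-)
proof (induction "(\<P>c, \<Phi>c)" trc "(\<P>c', \<Phi>c')" arbitrary: \<P>c \<Phi>c \<P> \<Phi> S tr l rule: compressed.induct)
  case comp_nil
  then show ?case using sym_comp_nil by fastforce
next
  case (comp_block Pc \<Phi>c trc1 Pc1 \<Phi>c1 \<Q>c trc2)
  obtain P \<Q> where P: "\<P> = add_mset P \<Q>" "Pc = psubst l P" "\<Q>c = image_mset (psubst l) \<Q>"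
    using msed_map_invR[of "psubst l" \<P> Pc \<Q>c] comp_block.prems(1) by metis
  obtain tr1 tr2 where tr: "tr = tr1 @ tr2" "trc1 = map (instantiate \<theta>) tr1"
    "trc2 = map (instantiate \<theta>) tr2"
    using comp_block.prems(3) unfolding append_eq_map_conv by blast
  have wfP: "wf_proc P \<Phi> S" using comp_block.prems(5) P(1) by auto
  have fresh: "set (inputs tr1) \<inter> so_vars S = {}" "distinct (inputs tr1)"
    using comp_block.prems(8,9) tr(1) by auto
  from focus_complete[OF inf comp_block.hyps(1) P(2) comp_block.prems(2) tr(2)
      comp_block.prems(4) wfP comp_block.prems(6,7) fresh]
  obtain r \<Phi>1 S1 l1 where f: "sym_focus In_Plus P \<Phi> S tr1 r \<Phi>1 S1" "canonical \<theta> \<Phi>1 S1 l1"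
    "sat \<Phi>1 S1 l1" "l \<subseteq>\<^sub>m l1" "Some Pc1 = map_option (psubst l1) r" "\<Phi>c1 = frame_subst l1 \<Phi>1"
    by blast
  then obtain P1 where r: "r = Some P1" "Pc1 = psubst l1 P1" by (cases r) auto
  note mono = sym_focus_mono[OF f(1)]
  have wf1: "wf_csys \<Phi>1 S1" "\<forall>Q\<in>#add_mset P1 \<Q>. wf_proc Q \<Phi>1 S1"
    using sym_focus_wf[OF f(1) comp_block.prems(4) wfP] r(1) comp_block.prems(5) P(1)
      wf_proc_mono[OF _ conjunct1[OF mono] conjunct2[OF mono]] by auto
  \<comment> \<open>The idle processes were instances under the old \<open>l\<close>; the induction
    hypothesis needs them as instances under the extended \<open>l1\<close>.\<close>
  have "\<Q>c = image_mset (psubst l1) \<Q>"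
    unfolding P(3) using comp_block.prems(5) P(1) psubst_extend[OF _ comp_block.prems(6) f(4)]
    by (intro image_mset_cong) auto
  then have "add_mset Pc1 \<Q>c = image_mset (psubst l1) (add_mset P1 \<Q>)" using r(2) by simp
  moreover have "set (inputs tr2) \<inter> so_vars S1 = {}" "distinct (inputs tr2)"
    using sym_focus_inputs[OF f(1)] comp_block.prems(8,9) tr(1) by auto
  ultimately obtain \<P>' \<Phi>' S' l'
    where *: "sym_compressed (add_mset P1 \<Q>, \<Phi>1, S1) tr2 (\<P>', \<Phi>', S')"
    "canonical \<theta> \<Phi>' S' l'" "sat \<Phi>' S' l'" "\<Phi>c' = frame_subst l' \<Phi>'"
    using comp_block.hyps(3)[OF _ f(6) tr(3) wf1 f(2,3)] by blast
  from sym_comp_block[OF f(1)[unfolded r(1)] *(1)] *(2-) show ?case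
    unfolding P(1) tr(1) by blast
next
  case (comp_failure Pc \<Phi>c trc1 \<Phi>c1 trc2 \<Q>c)
  obtain P \<Q> where P: "\<P> = add_mset P \<Q>" "Pc = psubst l P"
    using msed_map_invR[of "psubst l" \<P> Pc \<Q>c] comp_failure.prems(1) by metis
  obtain tr1 tr2 where tr: "tr = tr1 @ tr2" "trc1 = map (instantiate \<theta>) tr1"
    "trc2 = map (instantiate \<theta>) tr2"
    using comp_failure.prems(3) unfolding append_eq_map_conv by blast
  have wfP: "wf_proc P \<Phi> S" using comp_failure.prems(5) P(1) by auto
  have fresh: "set (inputs tr1) \<inter> so_vars S = {}" "distinct (inputs tr1)"
    using comp_failure.prems(8,9) tr(1) by auto
  from focus_complete[OF inf comp_failure.hyps(1) P(2) comp_failure.prems(2) tr(2)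
      comp_failure.prems(4) wfP comp_failure.prems(6,7) fresh]
  obtain r \<Phi>1 S1 l1 where f: "sym_focus In_Plus P \<Phi> S tr1 r \<Phi>1 S1" "canonical \<theta> \<Phi>1 S1 l1"
    "sat \<Phi>1 S1 l1" "None = map_option (psubst l1) r" "\<Phi>c1 = frame_subst l1 \<Phi>1"
    by blast
  then have r: "r = None" by simp
  have wf1: "wf_csys \<Phi>1 S1" using sym_focus_wf[OF f(1) comp_failure.prems(4) wfP] by blast
  have "\<exists>\<P>' \<Phi>' S' l'. sym_compressed ({#}, \<Phi>1, S1) tr2 (\<P>', \<Phi>', S') \<and>
    canonical \<theta> \<Phi>' S' l' \<and> sat \<Phi>' S' l' \<and> \<Phi>c' = frame_subst l' \<Phi>'"
    by (rule comp_failure.hyps(3)[OF _ f(5) tr(3) wf1 _ f(2,3)])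
      (use sym_focus_inputs[OF f(1)] comp_failure.prems(8,9) tr(1) in auto)
  then obtain \<P>' \<Phi>' S' l'
    where *: "sym_compressed ({#}, \<Phi>1, S1) tr2 (\<P>', \<Phi>', S')"
    "canonical \<theta> \<Phi>' S' l'" "sat \<Phi>' S' l'" "\<Phi>c' = frame_subst l' \<Phi>'"
    by blast
  from sym_comp_failure[OF f(1)[unfolded r] *(1)] *(2-) show ?case
    unfolding P(1) tr(1) by blast
qed

section \<open>Extended simple processes\<close>

lemma extended_simple_process_wf:
  assumes "extended_simple_process (\<P>, \<Phi>)"
  shows "frame_vars \<Phi> = {}" "wf_csys \<Phi> {}" "\<forall>P\<in>#\<P>. wf_proc P \<Phi> {}"
    and "canonical \<theta> \<Phi> {} Map.empty" "sat \<Phi> {} Map.empty"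
proof -
  show v: "frame_vars \<Phi> = {}"
    using assms valid_ground tvars_ground by (fastforce simp: frame_vars_def)
  show "wf_csys \<Phi> {}"
    using assms by (intro wf_init v) (auto intro: terms_over_UNIV[OF valid_ground])
  show "\<forall>P\<in>#\<P>. wf_proc P \<Phi> {}"
    using assms by (fastforce simp: wf_proc_def simple_process_def)
  show "canonical \<theta> \<Phi> {} Map.empty" "sat \<Phi> {} Map.empty"
    using v assms by (auto simp: canonical_def sat_def)
qed

text \<open>Soundness yields a run of the instance of the initial state under \<open>l\<close>. As
  that state is closed, it is its own instance.\<close>

lemma concrete_of_symbolic:
  assumes A: "extended_simple_process (\<P>, \<Phi>)"
    and run: "sym_compressed (\<P>, \<Phi>, {}) tr (\<P>', \<Phi>', S')" and sol: "\<theta> \<in> Sol (\<Phi>', S')"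
  obtains \<P>c \<Phi>c where "compressed (\<P>, \<Phi>) (map (instantiate \<theta>) tr) (\<P>c, \<Phi>c)"
    "frame_veq (frame_subst (fo_subst (\<Phi>', S') \<theta>) \<Phi>') \<Phi>c"
proof -
  have wf: "wf_csys \<Phi>' S'"
    using sym_compressed_wf[OF run] extended_simple_process_wf[OF A] by blast
  from Sol_canonical[OF this sol] obtain l where l: "canonical \<theta> \<Phi>' S' l" "sat \<Phi>' S' l" .
  have "image_mset (psubst l) \<P> = \<P>"
  proof -
    have "image_mset (psubst l) \<P> = image_mset id \<P>"
      using A by (intro image_mset_cong) (auto intro: psubst_closed)
    then show ?thesis by simp
  qed
  moreover have "frame_subst l \<Phi> = \<Phi>"
    using extended_simple_process_wf(1)[OF A] by (rule frame_subst_closed)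
  ultimately show thesis
    using sym_compressed_sound[OF run l] fo_subst_frame_veq[OF wf l] that by metis
qed

text \<open>Trace and \<theta> are parameters because the process on the right of the inclusion must
  reuse those given for the process on the left. The lifting starts from the empty substitution,
  canonical for the empty constraint set.\<close>

lemma symbolic_of_concrete:
  assumes "infinite (UNIV :: 'x set)" and A: "extended_simple_process (\<P>, \<Phi>)"
    and run: "compressed (\<P>, \<Phi>) (map (instantiate \<theta>) tr) (\<P>c, \<Phi>c)"
    and tr: "distinct (inputs tr)" "dom \<theta> = set (inputs tr)"
  obtains \<P>' \<Phi>' S' where "sym_compressed (\<P>, \<Phi>, {}) tr (\<P>', \<Phi>', S')" "\<theta> \<in> Sol (\<Phi>', S')"
    "frame_veq (frame_subst (fo_subst (\<Phi>', S') \<theta>) \<Phi>') \<Phi>c"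
proof -
  note wf = extended_simple_process_wf[OF A]
  have "\<P> = image_mset (psubst Map.empty) \<P>" by (simp add: psubst_empty[abs_def])
  from compressed_complete[OF assms(1) run this _ refl wf(2,3,4,5)] tr
  obtain \<P>' \<Phi>' S' l' where *: "sym_compressed (\<P>, \<Phi>, {}) tr (\<P>', \<Phi>', S')"
    "canonical \<theta> \<Phi>' S' l'" "sat \<Phi>' S' l'" "\<Phi>c = frame_subst l' \<Phi>'"
    by auto
  have "dom \<theta> = so_vars S'" using sym_compressed_inputs[OF *(1)] tr(2) by simp
  moreover have "wf_csys \<Phi>' S'" using sym_compressed_wf[OF *(1) wf(2,3)] .
  ultimately show thesis
    using that[OF *(1) canonical_Sol[OF *(2,3)]] fo_subst_frame_veq[OF _ *(2,3)] *(4) by blast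
qed

lemma comp_incl_iff_sym_comp_incl:
  assumes inf: "infinite (UNIV :: 'x set)"
    and A: "extended_simple_process (\<P>, \<Phi>)" and B: "extended_simple_process (\<Q>, \<Psi>)"
  shows "comp_incl (\<P>, \<Phi>) (\<Q>, \<Psi>) \<longleftrightarrow> sym_comp_incl (\<P>, \<Phi>) (\<Q>, \<Psi>)"
proof
  assume incl: "comp_incl (\<P>, \<Phi>) (\<Q>, \<Psi>)"
  show "sym_comp_incl (\<P>, \<Phi>) (\<Q>, \<Psi>)"
    unfolding sym_comp_incl.simps
  proof (intro allI impI, elim conjE)
    fix tr \<P>' \<Phi>' S\<^sub>A \<theta>
    assume run: "sym_compressed (\<P>, \<Phi>, {}) tr (\<P>', \<Phi>', S\<^sub>A)" and sol: "\<theta> \<in> Sol (\<Phi>', S\<^sub>A)"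
    from concrete_of_symbolic[OF A run sol] obtain \<P>c \<Phi>c
      where a: "compressed (\<P>, \<Phi>) (map (instantiate \<theta>) tr) (\<P>c, \<Phi>c)"
        "frame_veq (frame_subst (fo_subst (\<Phi>', S\<^sub>A) \<theta>) \<Phi>') \<Phi>c" .
    from incl a(1) obtain \<Q>c \<Psi>c
      where b: "compressed (\<Q>, \<Psi>) (map (instantiate \<theta>) tr) (\<Q>c, \<Psi>c)" "static_equiv \<Phi>c \<Psi>c"
      unfolding comp_incl_def by blast
    \<comment> \<open>Both facts come from the run of the left process and its solution, but concern
      only the trace and \<theta>; this is what permits lifting the right process with the same
      \<theta>.\<close>
    have "distinct (inputs tr)" "dom \<theta> = set (inputs tr)"
      using sym_compressed_inputs[OF run] sol by (auto simp: Sol_def)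
    from symbolic_of_concrete[OF inf B b(1) this] obtain \<Q>' \<Psi>' S\<^sub>B
      where c: "sym_compressed (\<Q>, \<Psi>, {}) tr (\<Q>', \<Psi>', S\<^sub>B)" "\<theta> \<in> Sol (\<Psi>', S\<^sub>B)"
        "frame_veq (frame_subst (fo_subst (\<Psi>', S\<^sub>B) \<theta>) \<Psi>') \<Psi>c" .
    have "static_equiv (frame_subst (fo_subst (\<Phi>', S\<^sub>A) \<theta>) \<Phi>')
        (frame_subst (fo_subst (\<Psi>', S\<^sub>B) \<theta>) \<Psi>')"
      using a(2) b(2) c(3) by (meson static_equiv_trans static_equiv_frame_veq frame_veq_sym)
    with c show "\<exists>\<Q>' \<Psi>' S\<^sub>B. sym_compressed (\<Q>, \<Psi>, {}) tr (\<Q>', \<Psi>', S\<^sub>B) \<and> \<theta> \<in> Sol (\<Psi>', S\<^sub>B) \<and>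
        static_equiv (frame_subst (fo_subst (\<Phi>', S\<^sub>A) \<theta>) \<Phi>')
          (frame_subst (fo_subst (\<Psi>', S\<^sub>B) \<theta>) \<Psi>')"
      by blast
  qed
next
  assume incl: "sym_comp_incl (\<P>, \<Phi>) (\<Q>, \<Psi>)"
  show "comp_incl (\<P>, \<Phi>) (\<Q>, \<Psi>)"
    unfolding comp_incl_def
  proof (intro allI impI)
    fix trc \<P>c \<Phi>c assume run: "compressed (\<P>, \<Phi>) trc (\<P>c, \<Phi>c)"
    obtain tr and \<theta> :: "sovar \<rightharpoonup> _"
      where tr: "map (instantiate \<theta>) tr = trc" "distinct (inputs tr)" "dom \<theta> = set (inputs tr)"
      by (rule trace_lifting[of trc])
    from symbolic_of_concrete[OF inf A run[folded tr(1)] tr(2,3)] obtain \<P>' \<Phi>' S\<^sub>A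
      where a: "sym_compressed (\<P>, \<Phi>, {}) tr (\<P>', \<Phi>', S\<^sub>A)" "\<theta> \<in> Sol (\<Phi>', S\<^sub>A)"
        "frame_veq (frame_subst (fo_subst (\<Phi>', S\<^sub>A) \<theta>) \<Phi>') \<Phi>c" .
    from incl a(1,2) obtain \<Q>' \<Psi>' S\<^sub>B
      where b: "sym_compressed (\<Q>, \<Psi>, {}) tr (\<Q>', \<Psi>', S\<^sub>B)" "\<theta> \<in> Sol (\<Psi>', S\<^sub>B)"
        "static_equiv (frame_subst (fo_subst (\<Phi>', S\<^sub>A) \<theta>) \<Phi>')
          (frame_subst (fo_subst (\<Psi>', S\<^sub>B) \<theta>) \<Psi>')"
      unfolding sym_comp_incl.simps by blast
    from concrete_of_symbolic[OF B b(1,2)] obtain \<Q>c \<Psi>c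
      where c: "compressed (\<Q>, \<Psi>) trc (\<Q>c, \<Psi>c)"
        "frame_veq (frame_subst (fo_subst (\<Psi>', S\<^sub>B) \<theta>) \<Psi>') \<Psi>c"
      unfolding tr(1) .
    have "static_equiv \<Phi>c \<Psi>c"
      using a(3) b(3) c(2) by (meson static_equiv_trans static_equiv_frame_veq frame_veq_sym)
    with c(1) show "\<exists>\<Q>' \<Psi>'. compressed (\<Q>, \<Psi>) trc (\<Q>', \<Psi>') \<and> static_equiv \<Phi>c \<Psi>'" by blast
  qed
qed

end

theorem theorem2:
  fixes ar :: "'f \<Rightarrow> nat"
    and E :: "('f, 'n, 'x::infinite) msg rel"
    and M :: "('f, 'n, 'x) msg set"
    and A B :: "('f, 'n, 'x, 'c, 'w::infinite) eproc"
  assumes "term_model ar E M"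
    and "term_model.extended_simple_process ar E M A"
    and "term_model.extended_simple_process ar E M B"
  shows "term_model.comp_incl ar E M A B \<longleftrightarrow> term_model.sym_comp_incl ar E M A B"
proof -
  interpret term_model ar E M by fact
  show ?thesis
    using comp_incl_iff_sym_comp_incl[OF infinite_UNIV] assms(2,3)
    by (cases A; cases B) auto
qed

end
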